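(* Let $\alpha<\omega_1$ be an ordinal with $\alpha=\omega^\alpha$. Then the class of all Banach spaces $X$ for which $\max(\mathrm{Sz}(X),\mathrm{Sz}(X^* ))\le\alpha$ is Borel in the Effros–Borel structure of closed subspaces of $C[0,1]$; that is, the set $$\{X\in\mathcal{SB}: \max(\mathrm{Sz}(X),\mathrm{Sz}(X^* ))\le\alpha\}$$ is Borel in $\mathcal{SB}$.
   Context: $\mathcal{SB}$ is the set of all closed linear subspaces of $C[0,1]$; its Effros–Borel structure is the $\sigma$-algebra generated by the sets $\{F\in\mathcal{SB}:F\cap U\neq\emptyset\}$, $U\subset C[0,1]$ open (every separable Banach space is isometric to an element of $\mathcal{SB}$). Szlenk index of a separable Banach space $Y$: for $K\subset Y^*$, $\varepsilon\ge0$ let $K'_\varepsilon=\{y^*\in Y^*:\exists(y_n^* )\subset K,\ w^*\text{-}\lim y_n^*=y^*,\ \|y_n^*-y^*\|>\varepsilon\text{ for all }n\}$; $K^{(0)}_\varepsilon=K$, $K^{(\alpha+1)}_\varepsilon=(K^{(\alpha)}_\varepsilon)'_\varepsilon$, $K^{(\lambda)}_\varepsilon=\bigcap_{\alpha<\lambda}K^{(\alpha)}_\varepsilon$ for limit $\lambda$. $\mathrm{Sz}(Y)=\sup_{\varepsilon>0}\sup\{\alpha<\omega_1:(B_{Y^*})^{(\alpha)}_\varepsilon\neq\emptyset\}$, where $B_{Y^*}$ is the unit ball of $Y^*$. For separable $Y$, $\mathrm{Sz}(Y)<\omega_1$ if and only if $Y^*$ is separable; so the condition $\max(\mathrm{Sz}(X),\mathrm{Sz}(X^*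 ))\le\alpha$ fails whenever $X^*$ is non-separable. *)

theory Defs
  imports
    "HOL-Analysis.Analysis"
    "HOL-Library.Function_Algebras"
    "HOL-Library.Countable_Set_Type"
begin

unbundle cardinal_syntax

section \<open>Ordinals\<close>

text \<open>
  The type \<open>ordinal\<close> consists of the ordinals below \<open>\<omega>\<^sub>2\<close>, represented by the elements of the initial
  well-order of cardinality \<open>\<aleph>\<^sub>2\<close>. It contains all ordinals up to and including \<open>\<omega>\<^sub>1\<close>, and every
  family of at most \<open>\<aleph>\<^sub>1\<close> of its members is bounded (\<open>bdd_above_ordinal\<close>; by \<open>card_lessThan_ordinal\<close> this
  covers the family of predecessors of any ordinal), so the suprema taken in this theory are the
  true ones.
\<close>

typedef ordinal = "Field (cardSuc (cardSuc natLeq))"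
proof -
  have "infinite (Field (cardSuc (cardSuc natLeq)))"
    using Cinfinite_cardSuc[OF Cinfinite_cardSuc[OF natLeq_Cinfinite]] by (simp add: cinfinite_def)
  then show ?thesis
    using infinite_imp_nonempty by blast
qed

lemma Cinfinite_ordinal: "Cinfinite (cardSuc (cardSuc natLeq))"
  by (simp add: Cinfinite_cardSuc natLeq_Cinfinite)

lemma Well_order_ordinal: "Well_order (cardSuc (cardSuc natLeq))"
  using Cinfinite_ordinal card_order_on_well_order_on by blast

instantiation ordinal :: wellorder
begin

definition "a \<le> b \<longleftrightarrow> (Rep_ordinal a, Rep_ordinal b) \<in> cardSuc (cardSuc natLeq)"
definition "a < b \<longleftrightarrow> a \<le> b \<and> a \<noteq> (b :: ordinal)"

instance
proof
  note W = Well_order_ordinal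
  have lin: "Linear_order (cardSuc (cardSuc natLeq))"
    using W by (simp add: well_order_on_def)
  have refl: "refl_on (Field (cardSuc (cardSuc natLeq))) (cardSuc (cardSuc natLeq))"
    and tr: "trans (cardSuc (cardSuc natLeq))"
    and as: "antisym (cardSuc (cardSuc natLeq))"
    and tot: "total_on (Field (cardSuc (cardSuc natLeq))) (cardSuc (cardSuc natLeq))"
    using lin by (simp_all add: order_on_defs)
  show le_refl: "x \<le> x" for x :: ordinal
    using refl Rep_ordinal[of x] by (auto simp: less_eq_ordinal_def refl_on_def)
  show "x \<le> z" if "x \<le> y" "y \<le> z" for x y z :: ordinal
    using tr that unfolding less_eq_ordinal_def by (meson transD)
  show antisymm: "x = y" if "x \<le> y" "y \<le> x" for x y :: ordinal
    using as that unfolding less_eq_ordinal_def by (meson antisymD Rep_ordinal_inject)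
  show "x < y \<longleftrightarrow> x \<le> y \<and> \<not> y \<le> x" for x y :: ordinal
    unfolding less_ordinal_def using antisymm le_refl by blast
  show "x \<le> y \<or> y \<le> x" for x y :: ordinal
  proof (cases "x = y")
    case False
    then show ?thesis
      using tot Rep_ordinal[of x] Rep_ordinal[of y]
      by (auto simp: less_eq_ordinal_def total_on_def Rep_ordinal_inject)
  qed (simp add: le_refl)
  show "P a" if *: "\<And>x. (\<And>y. y < x \<Longrightarrow> P y) \<Longrightarrow> P x" for P and a :: ordinal
  proof -
    have wf: "wf (cardSuc (cardSuc natLeq) - Id)"
      using W by (simp add: well_order_on_def)
    have "wf (inv_image (cardSuc (cardSuc natLeq) - Id) Rep_ordinal)"
      using wf by (rule wf_inv_image)
    moreover have "inv_image (cardSuc (cardSuc natLeq) - Id) Rep_ordinal = {(x, y). x < y}"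
      by (auto simp: less_ordinal_def less_eq_ordinal_def Rep_ordinal_inject)
    ultimately have "wf {(x, y). x < (y :: ordinal)}"
      by simp
    then show ?thesis
      by (induction a rule: wf_induct_rule) (use * in auto)
  qed
qed

end

instantiation ordinal :: conditionally_complete_linorder
begin

definition "inf = (min :: ordinal \<Rightarrow> ordinal \<Rightarrow> ordinal)"
definition "sup = (max :: ordinal \<Rightarrow> ordinal \<Rightarrow> ordinal)"
definition "Inf A = (LEAST a. a \<in> A)" for A :: "ordinal set"
definition "Sup A = (LEAST b. \<forall>a\<in>A. a \<le> b)" for A :: "ordinal set"

instance
proof
  show "Inf X \<le> x" if "x \<in> X" for x and X :: "ordinal set"
    unfolding Inf_ordinal_def using that by (rule Least_le)
  show "z \<le> Inf X" if "X \<noteq> {}" "\<And>x. x \<in> X \<Longrightarrow> z \<le> x" for z and X :: "ordinal set"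
    unfolding Inf_ordinal_def using that by (metis LeastI ex_in_conv)
  show "x \<le> Sup X" if "x \<in> X" "bdd_above X" for x and X :: "ordinal set"
    unfolding Sup_ordinal_def using that LeastI_ex[of "\<lambda>b. \<forall>a\<in>X. a \<le> b"]
    by (auto simp: bdd_above_def)
  show "Sup X \<le> z" if "X \<noteq> {}" "\<And>x. x \<in> X \<Longrightarrow> x \<le> z" for z and X :: "ordinal set"
    unfolding Sup_ordinal_def using that by (intro Least_le) auto
qed (auto simp: inf_ordinal_def sup_ordinal_def)

end

lemma bdd_above_ordinal:
  fixes A :: "ordinal set"
  assumes "|A| \<le>o cardSuc natLeq"
  shows "bdd_above A"
proof (rule ccontr)
  let ?r = "cardSuc (cardSuc natLeq)"
  assume nb: "\<not> bdd_above A"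
  have "cofinal (Rep_ordinal ` A) ?r"
    unfolding cofinal_def
  proof
    fix a assume "a \<in> Field ?r"
    then obtain x where x: "a = Rep_ordinal x"
      by (metis Abs_ordinal_inverse)
    obtain y where "y \<in> A" "x < y"
      using nb by (auto simp: bdd_above_def not_le)
    then show "\<exists>b\<in>Rep_ordinal ` A. a \<noteq> b \<and> (a, b) \<in> ?r"
      by (auto simp: x less_ordinal_def less_eq_ordinal_def Rep_ordinal_inject)
  qed
  moreover have "Rep_ordinal ` A \<subseteq> Field ?r"
    using Rep_ordinal by auto
  moreover have "regularCard ?r"
    by (intro regularCard_cardSuc Cinfinite_cardSuc natLeq_Cinfinite)
  ultimately have "( |Rep_ordinal ` A|, ?r) \<in> ordIso"
    by (auto simp: regularCard_def)
  moreover have "|Rep_ordinal ` A| \<le>o |A|"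
    by (rule card_of_image)
  moreover have "cardSuc natLeq <o ?r"
    by (simp add: cardSuc_greater cardSuc_Card_order natLeq_Card_order)
  ultimately show False
    using assms by (meson not_ordLess_ordLeq ordIso_symmetric ordLeq_transitive ordIso_ordLeq_trans)
qed

lemma card_lessThan_ordinal: "|{..<a :: ordinal}| \<le>o cardSuc natLeq"
proof -
  let ?r = "cardSuc (cardSuc natLeq)"
  have "Rep_ordinal ` {..<a} \<subseteq> underS ?r (Rep_ordinal a)"
    by (auto simp: underS_def less_ordinal_def less_eq_ordinal_def Rep_ordinal_inject)
  moreover have "inj_on Rep_ordinal {..<a}"
    by (simp add: inj_on_def Rep_ordinal_inject)
  ultimately have "|{..<a}| \<le>o |underS ?r (Rep_ordinal a)|"
    using card_of_ordLeq by blast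
  moreover have "|underS ?r (Rep_ordinal a)| <o ?r"
    using Cinfinite_ordinal Rep_ordinal by (intro card_of_underS) auto
  ultimately have "|{..<a}| <o ?r"
    by (rule ordLeq_ordLess_trans)
  then show ?thesis
    by (simp add: cardSuc_ordLeq_ordLess cardSuc_Card_order natLeq_Card_order card_of_Card_order)
qed

instantiation ordinal :: zero
begin
definition "0 = (LEAST a :: ordinal. True)"
instance ..
end

definition osucc :: "ordinal \<Rightarrow> ordinal" where
  "osucc a = (LEAST b. a < b)"

lemma zero_le_ordinal [simp]: "0 \<le> (a :: ordinal)"
  unfolding zero_ordinal_def by (simp add: Least_le)

lemma less_osucc: "a < osucc a"
proof -
  have "\<exists>b. a < b"
  proof (rule ccontr)
    assume "\<nexists>b. a < b"
    then have "Rep_ordinal b = Rep_ordinal a \<or> (Rep_ordinal b, Rep_ordinal a) \<in> cardSuc (cardSuc natLeq)" for b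
      by (metis less_eq_ordinal_def not_le)
    moreover have "infinite (Field (cardSuc (cardSuc natLeq)))" "Card_order (cardSuc (cardSuc natLeq))"
      using Cinfinite_ordinal by (auto simp: cinfinite_def)
    ultimately obtain c where c: "c \<in> Field (cardSuc (cardSuc natLeq))"
      "Rep_ordinal a \<noteq> c" "(Rep_ordinal a, c) \<in> cardSuc (cardSuc natLeq)"
      using infinite_Card_order_limit Rep_ordinal by metis
    then have "a < Abs_ordinal c"
      by (auto simp: less_ordinal_def less_eq_ordinal_def Abs_ordinal_inverse)
    then show False
      using \<open>\<nexists>b. a < b\<close> by blast
  qed
  then show ?thesis
    unfolding osucc_def by (rule LeastI_ex)
qed

lemma osucc_le_iff: "osucc a \<le> b \<longleftrightarrow> a < b"
  using less_osucc unfolding osucc_def by (metis Least_le le_less_trans not_le)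

lemma osucc_inject [simp]: "osucc a = osucc b \<longleftrightarrow> a = b"
  by (metis antisym_conv3 less_osucc not_le osucc_le_iff)

lemma osucc_neq_zero [simp]: "osucc a \<noteq> 0"
  by (metis less_osucc not_le zero_le_ordinal)

text \<open>
  Transfinite recursion with a value at \<open>0\<close>, a successor step, and an operation collecting the
  earlier values at limits; the three cases are spelled out as \<open>ord_rec_0\<close>, \<open>ord_rec_osucc\<close> and
  \<open>ord_rec_limit\<close>.
\<close>

function ord_rec :: "'b \<Rightarrow> ('b \<Rightarrow> 'b) \<Rightarrow> ('b set \<Rightarrow> 'b) \<Rightarrow> ordinal \<Rightarrow> 'b" where
  "ord_rec z s l a =
    (if a = 0 then z
     else if \<exists>b. a = osucc b then s (ord_rec z s l (THE b. a = osucc b))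
     else l ((\<lambda>b. ord_rec z s l b) ` {..<a}))"
  by pat_completeness auto
termination
  by (relation "inv_image {(x, y). x < y} (\<lambda>(z, s, l, a). a)")
     (auto simp: wf less_osucc)

declare ord_rec.simps [simp del]

lemma ord_rec_0: "ord_rec z s l 0 = z"
  by (simp add: ord_rec.simps)

lemma ord_rec_osucc: "ord_rec z s l (osucc a) = s (ord_rec z s l a)"
  by (simp add: ord_rec.simps[of z s l "osucc a"])

lemma ord_rec_limit:
  "a \<noteq> 0 \<Longrightarrow> (\<nexists>b. a = osucc b) \<Longrightarrow> ord_rec z s l a = l (ord_rec z s l ` {..<a})"
  by (simp add: ord_rec.simps[of z s l a])

definition oadd :: "ordinal \<Rightarrow> ordinal \<Rightarrow> ordinal" where
  "oadd a = ord_rec a osucc Sup"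

definition omult :: "ordinal \<Rightarrow> ordinal \<Rightarrow> ordinal" where
  "omult a = ord_rec 0 (\<lambda>x. oadd x a) Sup"

text \<open>
  The limit clause \<open>a\<^sup>\<lambda> = sup {a\<^sup>\<beta> | \<beta> < \<lambda>}\<close> is the usual one for bases \<open>a > 0\<close>; only the base
  \<open>\<omega>\<close> is used.
\<close>

definition oexp :: "ordinal \<Rightarrow> ordinal \<Rightarrow> ordinal" where
  "oexp a = ord_rec (osucc 0) (\<lambda>x. omult x a) Sup"

definition omega :: ordinal where
  "omega = (LEAST a. infinite {..<a})"

definition omega1 :: ordinal where
  "omega1 = (LEAST a. uncountable {..<a})"

lemma uncountable_omega1: "uncountable {..<omega1}"
proof -
  have "\<exists>a :: ordinal. uncountable {..<a}"
  proof (rule ccontr)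
    assume *: "\<nexists>a :: ordinal. uncountable {..<a}"
    have "|{..<a}| \<le>o natLeq" for a :: ordinal
      using * by (metis countable_card_le_natLeq)
    have "( |UNIV :: ordinal set|, cardSuc (cardSuc natLeq)) \<in> ordIso"
    proof -
      have "bij_betw Rep_ordinal UNIV (Field (cardSuc (cardSuc natLeq)))"
        by (metis bij_betw_def inj_on_def Rep_ordinal_inject type_definition.Rep_range
            type_definition_ordinal)
      then show ?thesis
        by (meson Cinfinite_ordinal card_of_Field_ordIso card_of_ordIsoI ordIso_transitive)
    qed
    then have "cardSuc natLeq \<le>o |UNIV :: ordinal set|"
      by (meson cardSuc_Card_order cardSuc_ordLeq natLeq_Card_order ordIso_symmetric
          ordLeq_ordIso_trans)
    then have "|Field (cardSuc natLeq)| \<le>o |UNIV :: ordinal set|"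
      by (meson cardSuc_Card_order card_of_Field_ordIso natLeq_Card_order ordIso_ordLeq_trans)
    then obtain f :: "_ \<Rightarrow> ordinal" where f: "inj_on f (Field (cardSuc natLeq))"
      by (metis card_of_ordLeq)
    define A where "A = f ` Field (cardSuc natLeq)"
    have A: "( |A|, cardSuc natLeq) \<in> ordIso"
      unfolding A_def using f
      by (meson bij_betw_imageI cardSuc_Card_order card_of_Field_ordIso card_of_ordIsoI
          natLeq_Card_order ordIso_symmetric ordIso_transitive)
    then have "bdd_above A"
      by (intro bdd_above_ordinal ordIso_imp_ordLeq)
    then obtain b where "\<And>a. a \<in> A \<Longrightarrow> a \<le> b"
      by (auto simp: bdd_above_def)
    then have "A \<subseteq> {..<osucc b}"
      using less_osucc by (auto intro: le_less_trans)
    then have "countable A"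
      using * countable_subset by blast
    then have "cardSuc natLeq \<le>o natLeq"
      using A by (meson countable_card_le_natLeq ordIso_ordLeq_trans ordIso_symmetric)
    then show False
      using cardSuc_greater natLeq_Card_order not_ordLess_ordLeq by blast
  qed
  then show ?thesis
    unfolding omega1_def by (rule LeastI_ex)
qed

lemma less_omega1_iff: "a < omega1 \<longleftrightarrow> countable {..<a}"
proof
  show "countable {..<a}" if "a < omega1"
    using that not_less_Least unfolding omega1_def by blast
  show "a < omega1" if "countable {..<a}"
    using that uncountable_omega1 countable_subset[of "{..<omega1}" "{..<a}"]
    by (meson lessThan_subset_iff not_le)
qed

lemma infinite_omega: "infinite {..<omega}"
  unfolding omega_def by (rule LeastI[of _ omega1]) (use uncountable_omega1 countable_finite in blast)

unbundle no cardinal_syntax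

section \<open>The Banach space $C[0,1]$ and the Effros--Borel structure\<close>

typedef unit_interval = "{0..1 :: real}"
  by (rule exI[of _ 0]) simp

instantiation unit_interval :: metric_space
begin

definition "dist x y = dist (Rep_unit_interval x) (Rep_unit_interval y)"
definition "(uniformity :: (unit_interval \<times> unit_interval) filter) =
  (INF e\<in>{0<..}. principal {(x, y). dist x y < e})"
definition "open (U :: unit_interval set) \<longleftrightarrow>
  (\<forall>x\<in>U. \<forall>\<^sub>F (x', y) in uniformity. x' = x \<longrightarrow> y \<in> U)"

instance
  by standard
    (auto simp: dist_unit_interval_def uniformity_unit_interval_def open_unit_interval_def
      Rep_unit_interval_inject dist_triangle2)

end

text \<open>As \<open>[0,1]\<close> is compact, the bounded continuous functions on it are all the continuous ones.\<close>

type_synonym C01 = "unit_interval \<Rightarrow>\<^sub>C real"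

definition SB :: "C01 set set" where
  "SB = {F. subspace F \<and> closed F}"

definition effros_borel :: "C01 set measure" where
  "effros_borel = sigma SB {{F \<in> SB. F \<inter> U \<noteq> {}} | U. open U}"

section \<open>Dual spaces\<close>

instantiation "fun" :: (type, real_vector) real_vector
begin

definition "c *\<^sub>R f = (\<lambda>x. c *\<^sub>R f x)" for f :: "'a \<Rightarrow> 'b"

instance
  by standard (auto simp: scaleR_fun_def fun_eq_iff scaleR_add_right scaleR_add_left)

end

text \<open>
  A real normed space is given by a subspace \<open>S\<close> of some real vector space together with a
  function \<open>N\<close> that is a norm on \<open>S\<close>. Functionals on \<open>S\<close> are normalised to vanish off \<open>S\<close>, which
  makes the dual a subspace of the function space \<open>'a \<Rightarrow> real\<close>, so that the construction can be
  iterated.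
\<close>

definition dual :: "'a::real_vector set \<Rightarrow> ('a \<Rightarrow> real) \<Rightarrow> ('a \<Rightarrow> real) set" where
  "dual S N = {f.
     (\<forall>x\<in>S. \<forall>y\<in>S. f (x + y) = f x + f y) \<and>
     (\<forall>c. \<forall>x\<in>S. f (c *\<^sub>R x) = c * f x) \<and>
     (\<exists>C. \<forall>x\<in>S. \<bar>f x\<bar> \<le> C * N x) \<and>
     (\<forall>x. x \<notin> S \<longrightarrow> f x = 0)}"

definition dual_norm :: "'a::real_vector set \<Rightarrow> ('a \<Rightarrow> real) \<Rightarrow> ('a \<Rightarrow> real) \<Rightarrow> real" where
  "dual_norm S N f = (SUP x\<in>{x \<in> S. N x \<le> 1}. \<bar>f x\<bar>)"

definition dual_ball :: "'a::real_vector set \<Rightarrow> ('a \<Rightarrow> real) \<Rightarrow> ('a \<Rightarrow> real) set" where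
  "dual_ball S N = {f \<in> dual S N. dual_norm S N f \<le> 1}"

definition weak_star_lim ::
    "'a::real_vector set \<Rightarrow> (nat \<Rightarrow> 'a \<Rightarrow> real) \<Rightarrow> ('a \<Rightarrow> real) \<Rightarrow> bool" where
  "weak_star_lim S u f \<longleftrightarrow> (\<forall>x\<in>S. (\<lambda>n. u n x) \<longlonglongrightarrow> f x)"

lemma subspace_dual: "subspace (dual S N)"
proof (rule subspaceI)
  show "0 \<in> dual S N"
    by (auto simp: dual_def intro: exI[of _ 0])
next
  fix f g assume f: "f \<in> dual S N" and g: "g \<in> dual S N"
  then obtain C D where "\<forall>x\<in>S. \<bar>f x\<bar> \<le> C * N x" "\<forall>x\<in>S. \<bar>g x\<bar> \<le> D * N x"
    by (auto simp: dual_def)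
  then have "\<forall>x\<in>S. \<bar>f x + g x\<bar> \<le> (C + D) * N x"
    by (auto simp: distrib_right intro: order_trans[OF abs_triangle_ineq] add_mono)
  with f g show "f + g \<in> dual S N"
    by (auto simp: dual_def distrib_left)
next
  fix c :: real and f assume f: "f \<in> dual S N"
  then obtain C where "\<forall>x\<in>S. \<bar>f x\<bar> \<le> C * N x"
    by (auto simp: dual_def)
  then have "\<forall>x\<in>S. \<bar>c * f x\<bar> \<le> (\<bar>c\<bar> * C) * N x"
    by (auto simp: abs_mult mult.assoc intro: mult_left_mono)
  with f show "c *\<^sub>R f \<in> dual S N"
    by (auto simp: dual_def scaleR_fun_def distrib_left)
qed

section \<open>The Szlenk index\<close>

definition szlenk_derivative ::
    "'a::real_vector set \<Rightarrow> ('a \<Rightarrow> real) \<Rightarrow> real \<Rightarrow> ('a \<Rightarrow> real) set \<Rightarrow> ('a \<Rightarrow> real) set" where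
  "szlenk_derivative S N \<epsilon> K = {f \<in> dual S N.
     \<exists>u. range u \<subseteq> K \<and> weak_star_lim S u f \<and> (\<forall>n. dual_norm S N (u n - f) > \<epsilon>)}"

definition szlenk_iterate ::
    "'a::real_vector set \<Rightarrow> ('a \<Rightarrow> real) \<Rightarrow> real \<Rightarrow> ('a \<Rightarrow> real) set \<Rightarrow> ordinal \<Rightarrow> ('a \<Rightarrow> real) set"
  where
  "szlenk_iterate S N \<epsilon> K = ord_rec K (szlenk_derivative S N \<epsilon>) Inter"

definition szlenk_index :: "'a::real_vector set \<Rightarrow> ('a \<Rightarrow> real) \<Rightarrow> ordinal" where
  "szlenk_index S N =
     (SUP \<epsilon>\<in>{0<..}. Sup {a. a < omega1 \<and> szlenk_iterate S N \<epsilon> (dual_ball S N) a \<noteq> {}})"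

end

theory Submission
  imports Defs
begin

text \<open>
  A dense sequence in the unit ball of \<open>X\<close> embeds \<open>(B\<^bsub>X*\<^esub>, w*)\<close> as a compact set \<open>E X\<close> of real sequences,
  on which the norm of \<open>X*\<close> becomes the supremum distance. Up to a change of \<open>\<epsilon>\<close>, which is harmless
  for the index, the Szlenk derivative is the closed derivative removing all relatively open sets of
  diameter at most \<open>\<epsilon>\<close>. For a family \<open>K X\<close> of compact sets such that \<open>{X. K X \<inter> C \<noteq> {}}\<close> is measurable
  for every closed \<open>C\<close>, compactness expresses "the derivative misses \<open>C\<close>" through countably many
  conditions of the same kind, so the property passes to all countable iterates, and
  \<open>{X. Sz X \<le> \<alpha>}\<close> is Borel. On this set \<open>X*\<close> is separable, and points selected measurably from small
  relatively open pieces of the iterates form a dense sequence in \<open>B\<^bsub>X*\<^esub>\<close>; the norms of its linear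
  combinations depend measurably on \<open>X\<close>, so the argument applies again to \<open>X*\<close>.
\<close>

section \<open>Cantor--Bendixson-type derivatives of compact sets of sequences\<close>

text \<open>The obstacle is that the definition of the index quantifies over all functionals and all
  weak* convergent sequences. The way around it is to let a space enter only through the norms of
  finite linear combinations of its dense sequence: these numbers determine the coded ball, which
  lives in one fixed space of sequences whatever the type of the original vectors. So one argument
  serves both \<open>X\<close> and its dual, whose elements are functions on \<open>C01\<close>. The
  change of \<epsilon> is by the factor 2: if two points are more than 2\<epsilon> apart, one of
  them is more than \<epsilon> away from any given third point. The supremum over all positive
  \<epsilon> absorbs this factor. At limit stages, measurability survives because a decreasing
  family of compact sets meets a closed set in a common point as soon as each member meets it. For
  countable \<alpha>, index at most \<alpha> means that stage \<alpha>+1 is empty for every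
  \<epsilon> of the form 1/(m+1). The condition on \<open>X\<close> is imposed first, as a
  restriction of the parameter space: the construction of a dense sequence in the dual ball relies
  on the derivatives being exhausted at a fixed countable stage.\<close>

lemma ordinal_limit_induct [case_names zero osucc limit]:
  assumes "P 0"
    and "\<And>a. P a \<Longrightarrow> P (osucc a)"
    and "\<And>a. a \<noteq> 0 \<Longrightarrow> \<nexists>b. a = osucc b \<Longrightarrow> (\<And>b. b < a \<Longrightarrow> P b) \<Longrightarrow> P a"
  shows "P (a :: ordinal)"
proof (induction a rule: less_induct)
  case (less a)
  then show ?case
    using assms less_osucc by metis
qed

text \<open>Distance is uniform in all coordinates, whereas open and compact sets refer to the
  product topology. The former corresponds to the dual norm (\<open>dual_norm_diff_le_iff\<close>),
  the latter to the weak* topology.\<close>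

definition coord_small :: "real \<Rightarrow> (nat \<Rightarrow> real) set \<Rightarrow> bool" where
  "coord_small e A \<longleftrightarrow> (\<forall>g\<in>A. \<forall>h\<in>A. \<forall>i. \<bar>g i - h i\<bar> \<le> e)"

definition sz_deriv :: "real \<Rightarrow> (nat \<Rightarrow> real) set \<Rightarrow> (nat \<Rightarrow> real) set" where
  "sz_deriv e K = {g \<in> K. \<forall>U. open U \<longrightarrow> g \<in> U \<longrightarrow> \<not> coord_small e (K \<inter> U)}"

definition sz_iter :: "real \<Rightarrow> (nat \<Rightarrow> real) set \<Rightarrow> ordinal \<Rightarrow> (nat \<Rightarrow> real) set" where
  "sz_iter e K = ord_rec K (sz_deriv e) Inter"

lemma sz_iter_0 [simp]: "sz_iter e K 0 = K"
  by (simp add: sz_iter_def ord_rec_0)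

lemma sz_iter_osucc [simp]: "sz_iter e K (osucc a) = sz_deriv e (sz_iter e K a)"
  by (simp add: sz_iter_def ord_rec_osucc)

lemma sz_iter_limit:
  "a \<noteq> 0 \<Longrightarrow> \<nexists>b. a = osucc b \<Longrightarrow> sz_iter e K a = (\<Inter>b<a. sz_iter e K b)"
  by (simp add: sz_iter_def ord_rec_limit)

lemma sz_deriv_subset: "sz_deriv e K \<subseteq> K"
  by (auto simp: sz_deriv_def)

lemma coord_small_mono: "coord_small e A \<Longrightarrow> B \<subseteq> A \<Longrightarrow> e \<le> d \<Longrightarrow> coord_small d B"
  unfolding coord_small_def by (meson order_trans subsetD)

lemma sz_deriv_mono:
  assumes "K \<subseteq> L" "d \<le> e"
  shows "sz_deriv e K \<subseteq> sz_deriv d L"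
  using assms coord_small_mono[of d "L \<inter> _" "K \<inter> _" e] unfolding sz_deriv_def by blast

lemma sz_iter_antimono_eps: "d \<le> e \<Longrightarrow> sz_iter e K a \<subseteq> sz_iter d K a"
proof (induction a rule: ordinal_limit_induct)
  case (osucc a)
  then show ?case
    by (simp add: sz_deriv_mono)
next
  case (limit a)
  then show ?case
    by (fastforce simp: sz_iter_limit)
qed simp

lemma sz_iter_antimono: "a \<le> b \<Longrightarrow> sz_iter e K b \<subseteq> sz_iter e K a"
proof (induction b rule: ordinal_limit_induct)
  case zero
  then show ?case
    by (metis antisym order_refl zero_le_ordinal)
next
  case (osucc b)
  show ?case
  proof (cases "a \<le> b")
    case True
    then show ?thesis
      using osucc.IH sz_deriv_subset by fastforce
  next
    case False
    then have "a = osucc b"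
      using osucc.prems by (meson not_le order.antisym osucc_le_iff)
    then show ?thesis by simp
  qed
next
  case (limit b)
  then show ?case
    by (cases "a = b") (auto simp: sz_iter_limit[of b])
qed

lemma sz_deriv_eq: "sz_deriv e K = K - \<Union>{U. open U \<and> coord_small e (K \<inter> U)}"
  by (auto simp: sz_deriv_def)

lemma compact_sz_deriv: "compact K \<Longrightarrow> compact (sz_deriv e K)"
  unfolding sz_deriv_eq by (intro compact_diff open_Union) auto

lemma compact_sz_iter: "compact K \<Longrightarrow> compact (sz_iter e K a)"
proof (induction a rule: ordinal_limit_induct)
  case (limit a)
  then have "closed (sz_iter e K a)"
    by (auto simp: sz_iter_limit compact_imp_closed)
  moreover have "sz_iter e K a \<subseteq> K"
    using sz_iter_antimono[of 0 a e K] by simp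
  ultimately show ?case
    using limit.prems by (metis compact_Int_closed inf.absorb2)
qed (auto simp: compact_sz_deriv)

text \<open>The closures matter because measurability is available only for hitting closed sets:
  smallness is tested on \<open>closure (B n)\<close>, while covering uses the open
  \<open>B n\<close>.\<close>

lemma ex_countable_shrinking_base:
  "\<exists>B :: nat \<Rightarrow> 'a::{metric_space, second_countable_topology} set. (\<forall>n. open (B n)) \<and>
     (\<forall>U g. open U \<longrightarrow> g \<in> U \<longrightarrow> (\<exists>n. g \<in> B n \<and> closure (B n) \<subseteq> U))"
proof -
  obtain \<B> :: "'a set set" where \<B>: "countable \<B>" "topological_basis \<B>"
    using ex_countable_basis by blast
  have "\<exists>n. g \<in> from_nat_into \<B> n \<and> closure (from_nat_into \<B> n) \<subseteq> U"
    if U: "open U" "g \<in> U" for U g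
  proof -
    obtain r where r: "r > 0" "cball g r \<subseteq> U"
      using U open_contains_cball by blast
    have "open (ball g r)" "g \<in> ball g r"
      using r(1) by auto
    then obtain V where V: "V \<in> \<B>" "g \<in> V" "V \<subseteq> ball g r"
      by (rule topological_basisE[OF \<B>(2)])
    have "closure V \<subseteq> cball g r"
      using V(3) by (meson ball_subset_cball closed_cball closure_minimal order_trans)
    then show ?thesis
      using V r(2) \<B>(1) by (metis from_nat_into_to_nat_on order_trans)
  qed
  moreover have "open (from_nat_into \<B> n)" for n
    using \<B>(2) topological_basis_open
    by (metis from_nat_into empty_iff open_empty topological_basis_def Union_empty empty_subsetI
        topological_basisE open_UNIV UNIV_I)
  ultimately show ?thesis
    by blast
qed

section \<open>Measurable families of compact sets\<close>

text \<open>With closed test sets, missing \<open>C\<close> becomes a statement about an open cover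
  of the compact set \<open>K \<omega> \<inter> C\<close>. Nonemptiness is the case
  \<open>C = UNIV\<close>.\<close>

definition hit_measurable :: "'w measure \<Rightarrow> ('w \<Rightarrow> 'b::topological_space set) \<Rightarrow> bool" where
  "hit_measurable M K \<longleftrightarrow> (\<forall>\<omega>\<in>space M. compact (K \<omega>)) \<and>
     (\<forall>C. closed C \<longrightarrow> Measurable.pred M (\<lambda>\<omega>. K \<omega> \<inter> C \<noteq> {}))"

lemma hit_measurable_compact: "hit_measurable M K \<Longrightarrow> \<omega> \<in> space M \<Longrightarrow> compact (K \<omega>)"
  by (simp add: hit_measurable_def)

lemma hit_measurable_pred: "hit_measurable M K \<Longrightarrow> closed C \<Longrightarrow> Measurable.pred M (\<lambda>\<omega>. K \<omega> \<inter> C \<noteq> {})"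
  by (simp add: hit_measurable_def)

lemma closed_coord_le: "closed {g :: nat \<Rightarrow> real. g i \<le> r}"
  by (intro closed_Collect_le continuous_on_const continuous_on_product_coordinates)

lemma closed_coord_ge: "closed {g :: nat \<Rightarrow> real. r \<le> g i}"
  by (intro closed_Collect_le continuous_on_const continuous_on_product_coordinates)

text \<open>Two coordinates more than \<open>e\<close> apart leave room for rational thresholds that
  are still more than \<open>e\<close> apart. This turns largeness into a countable union of hits of
  closed half-spaces.\<close>

lemma not_coord_small_iff:
  "\<not> coord_small e A \<longleftrightarrow> (\<exists>i. \<exists>r s :: rat. e < of_rat s - of_rat r \<and>
     A \<inter> {g. g i \<le> of_rat r} \<noteq> {} \<and> A \<inter> {g. of_rat s \<le> g i} \<noteq> {})"
proof
  assume "\<not> coord_small e A"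
  then obtain g h i where gh: "g \<in> A" "h \<in> A" "e < h i - g i"
    unfolding coord_small_def by (smt (verit))
  \<comment> \<open>Half of the excess over \<open>e\<close>: moving each of the two values inwards
    by less than \<open>d\<close> keeps the gap above \<open>e\<close>.\<close>
  define d where "d = (h i - g i - e) / 2"
  have d: "d > 0"
    using gh by (simp add: d_def)
  obtain r where r: "r \<in> \<rat>" "g i < r" "r < g i + d"
    using Rats_dense_in_real[of "g i" "g i + d"] d by auto
  obtain s where s: "s \<in> \<rat>" "h i - d < s" "s < h i"
    using Rats_dense_in_real[of "h i - d" "h i"] d by auto
  obtain r' s' where rs': "r = of_rat r'" "s = of_rat s'"
    using r(1) s(1) by (auto elim!: Rats_cases)
  have "h i - d - (g i + d) = e"
    by (simp add: d_def field_simps)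
  then have "e < of_rat s' - of_rat r'"
    using r s rs' by linarith
  moreover have "g \<in> A \<inter> {g. g i \<le> of_rat r'}" "h \<in> A \<inter> {g. of_rat s' \<le> g i}"
    using gh r s rs' by auto
  ultimately show "\<exists>i. \<exists>r s :: rat. e < of_rat s - of_rat r \<and>
     A \<inter> {g. g i \<le> of_rat r} \<noteq> {} \<and> A \<inter> {g. of_rat s \<le> g i} \<noteq> {}"
    by blast
next
  assume "\<exists>i. \<exists>r s :: rat. e < of_rat s - of_rat r \<and>
     A \<inter> {g. g i \<le> of_rat r} \<noteq> {} \<and> A \<inter> {g. of_rat s \<le> g i} \<noteq> {}"
  then obtain i g h and r s :: rat
    where "e < of_rat s - of_rat r" "g \<in> A" "h \<in> A" "g i \<le> of_rat r" "of_rat s \<le> h i"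
    by blast
  moreover from this have "e < \<bar>h i - g i\<bar>"
    by linarith
  ultimately show "\<not> coord_small e A"
    unfolding coord_small_def by (meson not_le)
qed

lemma hit_measurable_coord_small:
  assumes K: "hit_measurable M K" and C: "closed C"
  shows "Measurable.pred M (\<lambda>\<omega>. coord_small e (K \<omega> \<inter> C))"
proof -
  have [measurable]: "Measurable.pred M (\<lambda>\<omega>. K \<omega> \<inter> C \<inter> {g. g i \<le> r} \<noteq> {})"
    "Measurable.pred M (\<lambda>\<omega>. K \<omega> \<inter> C \<inter> {g. r \<le> g i} \<noteq> {})" for i r
    using hit_measurable_pred[OF K closed_Int[OF C closed_coord_le]]
      hit_measurable_pred[OF K closed_Int[OF C closed_coord_ge]] by (simp_all add: Int_assoc)
  have "Measurable.pred M (\<lambda>\<omega>. \<not> (\<exists>i. \<exists>r s :: rat. e < of_rat s - of_rat r \<and>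
     K \<omega> \<inter> C \<inter> {g. g i \<le> of_rat r} \<noteq> {} \<and> K \<omega> \<inter> C \<inter> {g. of_rat s \<le> g i} \<noteq> {}))"
    by measurable
  then show ?thesis
    by (simp only: not_coord_small_iff[symmetric] not_not)
qed

text \<open>If the derivative misses \<open>C\<close>, every point of \<open>K \<inter> C\<close>
  lies in a basic set whose closure cuts a small piece from \<open>K\<close>, and finitely many of
  these cover \<open>K \<inter> C\<close>. The finite subcover is a list of naturals, so the
  existential quantifier is countable.\<close>

lemma sz_deriv_miss_iff:
  assumes K: "compact K" and C: "closed C" and B: "\<And>n. open (B n)"
    "\<And>U g. open U \<Longrightarrow> g \<in> U \<Longrightarrow> \<exists>n :: nat. g \<in> B n \<and> closure (B n) \<subseteq> U"
  shows "sz_deriv e K \<inter> C = {} \<longleftrightarrow>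
    (\<exists>L. (\<forall>n\<in>set L. coord_small e (K \<inter> closure (B n))) \<and> K \<inter> (C - (\<Union>n\<in>set L. B n)) = {})"
proof
  assume *: "sz_deriv e K \<inter> C = {}"
  define I where "I = {n. coord_small e (K \<inter> closure (B n))}"
  have "compact (K \<inter> C)"
    using K C by (simp add: compact_Int_closed)
  moreover have "K \<inter> C \<subseteq> (\<Union>n\<in>I. B n)"
  proof
    fix g assume g: "g \<in> K \<inter> C"
    then obtain U where U: "open U" "g \<in> U" "coord_small e (K \<inter> U)"
      using * by (auto simp: sz_deriv_def)
    then obtain n where "g \<in> B n" "closure (B n) \<subseteq> U"
      using B(2) by blast
    moreover from this have "n \<in> I"
      using U(3) unfolding I_def by (auto elim!: coord_small_mono)
    ultimately show "g \<in> (\<Union>n\<in>I. B n)"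
      by blast
  qed
  ultimately obtain F where F: "F \<subseteq> I" "finite F" "K \<inter> C \<subseteq> (\<Union>n\<in>F. B n)"
    using B(1) by (meson compactE_image)
  obtain L where "set L = F"
    using F(2) finite_list by blast
  then show "\<exists>L. (\<forall>n\<in>set L. coord_small e (K \<inter> closure (B n))) \<and>
      K \<inter> (C - (\<Union>n\<in>set L. B n)) = {}"
    using F unfolding I_def by (intro exI[of _ L]) blast
next
  assume "\<exists>L. (\<forall>n\<in>set L. coord_small e (K \<inter> closure (B n))) \<and>
      K \<inter> (C - (\<Union>n\<in>set L. B n)) = {}"
  then obtain L where L: "\<forall>n\<in>set L. coord_small e (K \<inter> closure (B n))"
    "K \<inter> (C - (\<Union>n\<in>set L. B n)) = {}"
    by blast
  have "g \<notin> sz_deriv e K" if g: "g \<in> K \<inter> C" for g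
  proof -
    obtain n where n: "n \<in> set L" "g \<in> B n"
      using g L(2) by blast
    have "coord_small e (K \<inter> B n)"
      using L(1) n(1) closure_subset[of "B n"] by (auto elim!: coord_small_mono)
    then show ?thesis
      using n B(1) by (auto simp: sz_deriv_def)
  qed
  then show "sz_deriv e K \<inter> C = {}"
    using sz_deriv_subset by blast
qed

lemma hit_measurable_sz_deriv:
  assumes K: "hit_measurable M K"
  shows "hit_measurable M (\<lambda>\<omega>. sz_deriv e (K \<omega>))"
  unfolding hit_measurable_def
proof (intro conjI ballI allI impI)
  show "compact (sz_deriv e (K \<omega>))" if "\<omega> \<in> space M" for \<omega>
    using hit_measurable_compact[OF K that] by (rule compact_sz_deriv)
  fix C :: "(nat \<Rightarrow> real) set" assume C: "closed C"
  obtain B :: "nat \<Rightarrow> (nat \<Rightarrow> real) set" where B: "\<And>n. open (B n)"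
    "\<And>U g. open U \<Longrightarrow> g \<in> U \<Longrightarrow> \<exists>n. g \<in> B n \<and> closure (B n) \<subseteq> U"
    using ex_countable_shrinking_base by metis
  have [measurable]: "Measurable.pred M (\<lambda>\<omega>. K \<omega> \<inter> (C - (\<Union>n\<in>set L. B n)) = {})" for L
  proof -
    have "closed (C - (\<Union>n\<in>set L. B n))"
      using C B(1) by (intro closed_Diff open_UN) auto
    note [measurable] = hit_measurable_pred[OF K this]
    have "Measurable.pred M (\<lambda>\<omega>. \<not> K \<omega> \<inter> (C - (\<Union>n\<in>set L. B n)) \<noteq> {})"
      by measurable
    then show ?thesis
      by simp
  qed
  have [measurable]: "Measurable.pred M (\<lambda>\<omega>. coord_small e (K \<omega> \<inter> closure (B n)))" for n
    using K by (rule hit_measurable_coord_small) simp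
  have "Measurable.pred M (\<lambda>\<omega>. \<not> (\<exists>L. (\<forall>n\<in>set L. coord_small e (K \<omega> \<inter> closure (B n))) \<and>
      K \<omega> \<inter> (C - (\<Union>n\<in>set L. B n)) = {}))"
    by measurable
  then show "Measurable.pred M (\<lambda>\<omega>. sz_deriv e (K \<omega>) \<inter> C \<noteq> {})"
    by (subst measurable_cong[where g = "\<lambda>\<omega>. \<not> (\<exists>L. (\<forall>n\<in>set L. coord_small e (K \<omega> \<inter> closure (B n))) \<and>
      K \<omega> \<inter> (C - (\<Union>n\<in>set L. B n)) = {})"])
      (use sz_deriv_miss_iff[OF hit_measurable_compact[OF K] C B] in blast)+
qed

text \<open>The finite intersection property, where the chain condition replaces a finite subfamily
  by its smallest member; hence hitting \<open>C\<close> one set at a time is enough.\<close>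

lemma compact_chain_Inter_hit:
  assumes K: "\<And>i. i \<in> I \<Longrightarrow> compact (K i)" and C: "closed C" and I: "I \<noteq> {}"
    and chain: "\<And>i j. i \<in> I \<Longrightarrow> j \<in> I \<Longrightarrow> K i \<subseteq> K j \<or> K j \<subseteq> K i"
    and hit: "\<And>i. i \<in> I \<Longrightarrow> K i \<inter> C \<noteq> ({} :: 'b::t2_space set)"
  shows "(\<Inter>i\<in>I. K i) \<inter> C \<noteq> {}"
proof
  assume *: "(\<Inter>i\<in>I. K i) \<inter> C = {}"
  obtain i\<^sub>0 where i\<^sub>0: "i\<^sub>0 \<in> I"
    using I by blast
  have "compact (K i\<^sub>0 \<inter> C)"
    using K[OF i\<^sub>0] C by (rule compact_Int_closed)
  moreover have "K i\<^sub>0 \<inter> C \<subseteq> (\<Union>i\<in>I. - K i)"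
    using * by blast
  ultimately obtain F where F: "F \<subseteq> I" "finite F" "K i\<^sub>0 \<inter> C \<subseteq> (\<Union>i\<in>F. - K i)"
    using K compact_imp_closed by (meson compactE_image open_Compl)
  have "\<exists>i\<in>I. K i \<subseteq> K i\<^sub>0 \<and> (\<forall>j\<in>F. K i \<subseteq> K j)"
    using F(2,1)
  proof (induction F)
    case empty
    then show ?case
      using i\<^sub>0 by blast
  next
    case (insert j F)
    then obtain i where "i \<in> I" "K i \<subseteq> K i\<^sub>0" "\<forall>j\<in>F. K i \<subseteq> K j"
      by auto
    moreover have "K i \<subseteq> K j \<or> K j \<subseteq> K i"
      using chain insert.prems calculation(1) by simp
    ultimately show ?case
      using insert.prems by blast
  qed
  then show False
    using F(3) hit by blast
qed

text \<open>At a limit \<open>a\<close>, compactness and monotonicity make hitting \<open>C\<close>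
  at stage \<open>a\<close> equivalent to hitting it at all earlier stages, and these are countably
  many because \<open>a < omega1\<close>.\<close>

lemma hit_measurable_sz_iter:
  assumes K: "hit_measurable M K" and a: "a < omega1"
  shows "hit_measurable M (\<lambda>\<omega>. sz_iter e (K \<omega>) a)"
  using a
proof (induction a rule: ordinal_limit_induct)
  case zero
  then show ?case
    using K by simp
next
  case (osucc a)
  then show ?case
    using less_osucc[of a] hit_measurable_sz_deriv[of M "\<lambda>\<omega>. sz_iter e (K \<omega>) a" e] by simp
next
  case (limit a)
  show ?case
    unfolding hit_measurable_def
  proof (intro conjI ballI allI impI)
    show "compact (sz_iter e (K \<omega>) a)" if "\<omega> \<in> space M" for \<omega>
      using hit_measurable_compact[OF K that] by (rule compact_sz_iter)
    fix C :: "(nat \<Rightarrow> real) set" assume C: "closed C"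
    have "countable {..<a}"
      using limit.prems less_omega1_iff by blast
    moreover have "Measurable.pred M (\<lambda>\<omega>. sz_iter e (K \<omega>) b \<inter> C \<noteq> {})" if "b < a" for b
      using limit that C by (intro hit_measurable_pred) auto
    ultimately have *: "Measurable.pred M (\<lambda>\<omega>. \<forall>b\<in>{..<a}. sz_iter e (K \<omega>) b \<inter> C \<noteq> {})"
      unfolding pred_def by (intro sets.sets_Collect_countable_All') auto
    have "0 < a"
      using limit(1) by (metis order_le_less zero_le_ordinal)
    have "sz_iter e (K \<omega>) a \<inter> C \<noteq> {} \<longleftrightarrow> (\<forall>b\<in>{..<a}. sz_iter e (K \<omega>) b \<inter> C \<noteq> {})"
      if "\<omega> \<in> space M" for \<omega>
    proof
      assume "sz_iter e (K \<omega>) a \<inter> C \<noteq> {}"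
      moreover have "sz_iter e (K \<omega>) a \<subseteq> sz_iter e (K \<omega>) b" if "b \<in> {..<a}" for b
        using that by (intro sz_iter_antimono) auto
      ultimately show "\<forall>b\<in>{..<a}. sz_iter e (K \<omega>) b \<inter> C \<noteq> {}"
        by blast
    next
      assume "\<forall>b\<in>{..<a}. sz_iter e (K \<omega>) b \<inter> C \<noteq> {}"
      moreover have "sz_iter e (K \<omega>) b \<subseteq> sz_iter e (K \<omega>) c \<or> sz_iter e (K \<omega>) c \<subseteq> sz_iter e (K \<omega>) b" for b c
        using sz_iter_antimono linear by metis
      ultimately have "(\<Inter>b\<in>{..<a}. sz_iter e (K \<omega>) b) \<inter> C \<noteq> {}"
        using C compact_sz_iter[OF hit_measurable_compact[OF K that]] \<open>0 < a\<close>
        by (intro compact_chain_Inter_hit) auto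
      then show "sz_iter e (K \<omega>) a \<inter> C \<noteq> {}"
        using limit(1,2) by (simp add: sz_iter_limit)
    qed
    then show "Measurable.pred M (\<lambda>\<omega>. sz_iter e (K \<omega>) a \<inter> C \<noteq> {})"
      using * by (subst measurable_cong) auto
  qed
qed

text \<open>If \<open>g\<close> violates constraint \<open>k\<close>, some rational \<open>q\<close>
  has \<open>r k \<omega> < q < l k g\<close>. By compactness finitely many pairs
  \<open>(k, q)\<close> exclude all of \<open>Q \<inter> C\<close>. Once the pairs are fixed, this
  exclusion does not depend on \<omega>; only the conditions \<open>r k \<omega> < q\<close>
  do.\<close>

lemma hit_measurable_constraints:
  fixes l :: "'k::countable \<Rightarrow> 'b::t2_space \<Rightarrow> real"
  assumes Q: "compact Q" and l: "\<And>k. continuous_on UNIV (l k)"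
    and r: "\<And>k. r k \<in> borel_measurable M"
  shows "hit_measurable M (\<lambda>\<omega>. {g \<in> Q. \<forall>k. l k g \<le> r k \<omega>})"
  unfolding hit_measurable_def
proof (intro conjI ballI allI impI)
  have cl: "closed {g. l k g \<le> q}" for k q
    using l by (intro closed_Collect_le) auto
  have "{g \<in> Q. \<forall>k. l k g \<le> r k \<omega>} = Q \<inter> (\<Inter>k. {g. l k g \<le> r k \<omega>})" for \<omega>
    by auto
  then show "compact {g \<in> Q. \<forall>k. l k g \<le> r k \<omega>}" for \<omega>
    using Q cl by (simp add: closed_INT compact_Int_closed)
  fix C :: "'b set" assume C: "closed C"
  have eq: "{g \<in> Q. \<forall>k. l k g \<le> r k \<omega>} \<inter> C = {} \<longleftrightarrow>
    (\<exists>L :: ('k \<times> rat) list. (\<forall>p\<in>set L. r (fst p) \<omega> < of_rat (snd p)) \<and>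
       Q \<inter> C \<inter> {g. \<forall>p\<in>set L. l (fst p) g \<le> of_rat (snd p)} = {})" for \<omega>
  proof
    assume *: "{g \<in> Q. \<forall>k. l k g \<le> r k \<omega>} \<inter> C = {}"
    define I where "I = {p :: 'k \<times> rat. r (fst p) \<omega> < of_rat (snd p)}"
    have "Q \<inter> C \<subseteq> (\<Union>p\<in>I. - {g. l (fst p) g \<le> of_rat (snd p)})"
    proof
      fix g assume "g \<in> Q \<inter> C"
      then obtain k where "r k \<omega> < l k g"
        using * by (fastforce simp: not_le)
      then obtain q where "r k \<omega> < of_rat q" "of_rat q < l k g"
        using of_rat_dense by blast
      then show "g \<in> (\<Union>p\<in>I. - {g. l (fst p) g \<le> of_rat (snd p)})"
        by (intro UN_I[of "(k, q)"]) (auto simp: I_def)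
    qed
    moreover have "compact (Q \<inter> C)"
      using Q C by (simp add: compact_Int_closed)
    ultimately obtain F where F: "F \<subseteq> I" "finite F"
      "Q \<inter> C \<subseteq> (\<Union>p\<in>F. - {g. l (fst p) g \<le> of_rat (snd p)})"
      using cl by (meson compactE_image open_Compl)
    obtain L where "set L = F"
      using F(2) finite_list by blast
    then show "\<exists>L :: ('k \<times> rat) list. (\<forall>p\<in>set L. r (fst p) \<omega> < of_rat (snd p)) \<and>
       Q \<inter> C \<inter> {g. \<forall>p\<in>set L. l (fst p) g \<le> of_rat (snd p)} = {}"
      using F by (intro exI[of _ L]) (auto simp: I_def)
  next
    assume "\<exists>L :: ('k \<times> rat) list. (\<forall>p\<in>set L. r (fst p) \<omega> < of_rat (snd p)) \<and>
       Q \<inter> C \<inter> {g. \<forall>p\<in>set L. l (fst p) g \<le> of_rat (snd p)} = {}"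
    then obtain L :: "('k \<times> rat) list" where
      L: "\<forall>p\<in>set L. r (fst p) \<omega> < of_rat (snd p)"
        "Q \<inter> C \<inter> {g. \<forall>p\<in>set L. l (fst p) g \<le> of_rat (snd p)} = {}"
      by blast
    have "l (fst p) g \<le> of_rat (snd p)" if "p \<in> set L" "\<forall>k. l k g \<le> r k \<omega>" for p g
      using L(1) that by (meson less_imp_le order_trans)
    then show "{g \<in> Q. \<forall>k. l k g \<le> r k \<omega>} \<inter> C = {}"
      using L(2) by blast
  qed
  have "Measurable.pred M (\<lambda>\<omega>. \<not> (\<exists>L :: ('k \<times> rat) list. (\<forall>p\<in>set L. r (fst p) \<omega> < of_rat (snd p)) \<and>
       Q \<inter> C \<inter> {g. \<forall>p\<in>set L. l (fst p) g \<le> of_rat (snd p)} = {}))"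
    using r by measurable
  then show "Measurable.pred M (\<lambda>\<omega>. {g \<in> Q. \<forall>k. l k g \<le> r k \<omega>} \<inter> C \<noteq> {})"
    by (simp only: eq)
qed

text \<open>A greedy decision procedure: step \<open>n\<close> leaves a set contained in
  \<open>H n\<close> or disjoint from it, without ever emptying a nonempty set.\<close>

primrec refine :: "(nat \<Rightarrow> 'b set) \<Rightarrow> 'b set \<Rightarrow> nat \<Rightarrow> 'b set" where
  "refine H K 0 = K"
| "refine H K (Suc n) = (if refine H K n \<inter> H n = {} then refine H K n else refine H K n \<inter> H n)"

lemma refine_antimono: "m \<le> n \<Longrightarrow> refine H K n \<subseteq> refine H K m"
  by (induction n rule: dec_induct) auto

lemma hit_measurable_refine:
  fixes K :: "'w \<Rightarrow> 'b::t2_space set"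
  assumes K: "hit_measurable M K" and H: "\<And>n. closed (H n)"
  shows "hit_measurable M (\<lambda>\<omega>. refine H (K \<omega>) n)"
proof (induction n)
  case (Suc n)
  show ?case
    unfolding hit_measurable_def
  proof (intro conjI ballI allI impI)
    show "compact (refine H (K \<omega>) (Suc n))" if "\<omega> \<in> space M" for \<omega>
      using hit_measurable_compact[OF Suc that] H by (auto intro: compact_Int_closed)
    fix C :: "'b set" assume C: "closed C"
    note [measurable] = hit_measurable_pred[OF Suc H[of n]] hit_measurable_pred[OF Suc C]
      hit_measurable_pred[OF Suc closed_Int[OF H[of n] C]]
    have "refine H (K \<omega>) (Suc n) \<inter> C \<noteq> {} \<longleftrightarrow>
      (if refine H (K \<omega>) n \<inter> H n \<noteq> {} then refine H (K \<omega>) n \<inter> (H n \<inter> C) \<noteq> {}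
       else refine H (K \<omega>) n \<inter> C \<noteq> {})" for \<omega>
      by (simp add: Int_assoc)
    moreover have "Measurable.pred M (\<lambda>\<omega>. if refine H (K \<omega>) n \<inter> H n \<noteq> {}
      then refine H (K \<omega>) n \<inter> (H n \<inter> C) \<noteq> {} else refine H (K \<omega>) n \<inter> C \<noteq> {})"
      by measurable
    ultimately show "Measurable.pred M (\<lambda>\<omega>. refine H (K \<omega>) (Suc n) \<inter> C \<noteq> {})"
      by presburger
  qed
qed (use K in simp)

text \<open>
  Deciding one rational half-space after another shrinks \<open>K \<omega>\<close> to a point, and membership of that
  point in the \<open>n\<close>-th half-space is decided at stage \<open>n\<close>.
\<close>

lemma hit_measurable_selection:
  fixes K :: "'w \<Rightarrow> (nat \<Rightarrow> real) set"
  assumes K: "hit_measurable M K" and ne: "\<And>\<omega>. \<omega> \<in> space M \<Longrightarrow> K \<omega> \<noteq> {}"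
  obtains s where "\<And>\<omega>. \<omega> \<in> space M \<Longrightarrow> s \<omega> \<in> K \<omega>" "\<And>i. (\<lambda>\<omega>. s \<omega> i) \<in> borel_measurable M"
proof -
  define H where "H n = (case from_nat n of (i, q) \<Rightarrow> {g :: nat \<Rightarrow> real. g i \<le> real_of_rat q})" for n
  have H: "closed (H n)" for n
    by (simp add: H_def closed_coord_le split: prod.split)
  \<comment> \<open>The arbitrary choice costs no measurability: \<open>sH\<close> below determines
    whether \<open>s \<omega> \<in> H n\<close> by a hitting condition.\<close>
  define s where "s \<omega> = (SOME g. \<forall>n. g \<in> refine H (K \<omega>) n)" for \<omega>
  have s: "s \<omega> \<in> refine H (K \<omega>) n" if \<omega>: "\<omega> \<in> space M" for \<omega> n
  proof -
    have "refine H (K \<omega>) n \<inter> UNIV \<noteq> {}" for n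
      using ne[OF \<omega>] by (induction n) auto
    moreover have "compact (refine H (K \<omega>) n)" for n
      using hit_measurable_compact[OF hit_measurable_refine[OF K H] \<omega>] .
    moreover have "refine H (K \<omega>) m \<subseteq> refine H (K \<omega>) n \<or> refine H (K \<omega>) n \<subseteq> refine H (K \<omega>) m" for m n
      using refine_antimono linear by metis
    ultimately have "(\<Inter>n. refine H (K \<omega>) n) \<inter> UNIV \<noteq> {}"
      by (intro compact_chain_Inter_hit) auto
    then have "\<exists>g. \<forall>n. g \<in> refine H (K \<omega>) n"
      by auto
    then show ?thesis
      unfolding s_def by (rule someI2_ex) simp
  qed
  have sH: "s \<omega> \<in> H n \<longleftrightarrow> refine H (K \<omega>) n \<inter> H n \<noteq> {}" if \<omega>: "\<omega> \<in> space M" for \<omega> n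
    using s[OF \<omega>, of n] s[OF \<omega>, of "Suc n"] by (auto split: if_splits)
  have meas: "Measurable.pred M (\<lambda>\<omega>. s \<omega> i \<le> real_of_rat q)" for i q
  proof -
    have "Measurable.pred M (\<lambda>\<omega>. s \<omega> \<in> H (to_nat (i, q)))"
      using hit_measurable_pred[OF hit_measurable_refine[OF K H] H] sH
      by (subst measurable_cong) auto
    then show ?thesis
      by (simp add: H_def)
  qed
  show ?thesis
  proof
    show "s \<omega> \<in> K \<omega>" if "\<omega> \<in> space M" for \<omega>
      using s[OF that, of 0] by simp
    show "(\<lambda>\<omega>. s \<omega> i) \<in> borel_measurable M" for i
    proof (subst borel_measurable_iff_le, intro allI)
      fix a :: real
      have "{\<omega> \<in> space M. s \<omega> i \<le> a} =
        {\<omega> \<in> space M. \<forall>q. a < real_of_rat q \<longrightarrow> s \<omega> i \<le> real_of_rat q}"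
        by (intro Collect_cong conj_cong refl)
          (meson less_le_not_le linorder_not_less of_rat_dense order_trans)
      moreover have "Measurable.pred M (\<lambda>\<omega>. \<forall>q. a < real_of_rat q \<longrightarrow> s \<omega> i \<le> real_of_rat q)"
        using meas by measurable
      ultimately show "{\<omega> \<in> space M. s \<omega> i \<le> a} \<in> sets M"
        by (simp only: pred_def)
    qed
  qed
qed

section \<open>Duals of spaces with a dense sequence in the unit ball\<close>

text \<open>Carrier and norm are parameters rather than type-class data, so that the locale can be
  instantiated again with \<open>dual S N\<close> and \<open>dual_norm S N\<close>.\<close>

locale coded_space =
  fixes S :: "'a::real_vector set" and N :: "'a \<Rightarrow> real" and y :: "nat \<Rightarrow> 'a"
  assumes subspace_S: "subspace S"
    and N_add: "x \<in> S \<Longrightarrow> z \<in> S \<Longrightarrow> N (x + z) \<le> N x + N z"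
    and N_scale: "x \<in> S \<Longrightarrow> N (c *\<^sub>R x) = \<bar>c\<bar> * N x"
    and y_in: "y i \<in> S"
    and y_le: "N (y i) \<le> 1"
    and y_dense: "x \<in> S \<Longrightarrow> N x \<le> 1 \<Longrightarrow> e > 0 \<Longrightarrow> \<exists>i. N (x - y i) < e"
begin

lemmas S_intros [simp, intro] = subspace_add[OF subspace_S] subspace_diff[OF subspace_S]
  subspace_scale[OF subspace_S] subspace_0[OF subspace_S] subspace_neg[OF subspace_S] y_in

lemma sum_in_S [simp, intro]: "(\<Sum>i<n. c i *\<^sub>R y i) \<in> S" for n :: nat
  by (induction n) auto

lemma N_0 [simp]: "N 0 = 0"
  using N_scale[of 0 0] by simp

lemma N_minus [simp]: "x \<in> S \<Longrightarrow> N (- x) = N x"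
  using N_scale[of x "-1"] by simp

lemma N_nonneg: "x \<in> S \<Longrightarrow> 0 \<le> N x"
  using N_add[of x "- x"] by auto

lemma N_diff_commute: "x \<in> S \<Longrightarrow> z \<in> S \<Longrightarrow> N (x - z) = N (z - x)"
  using N_minus[of "x - z"] by simp

lemma N_diff_triangle: "x \<in> S \<Longrightarrow> w \<in> S \<Longrightarrow> z \<in> S \<Longrightarrow> N (x - z) \<le> N (x - w) + N (w - z)"
  using N_add[of "x - w" "w - z"] by simp

lemma scaled_dense:
  assumes x: "x \<in> S" and e: "e > 0"
  obtains k i where "k > 0" "N (x - k *\<^sub>R y i) < e"
proof -
  \<comment> \<open>The summand 1 keeps \<open>k\<close> positive when
    \<open>N x = 0\<close>.\<close>
  define k where "k = N x + 1"
  have k: "k > 0"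
    using N_nonneg[OF x] by (simp add: k_def)
  have "N (x /\<^sub>R k) \<le> 1"
    using k x by (simp add: N_scale field_simps) (simp add: k_def)
  then obtain i where i: "N (x /\<^sub>R k - y i) < e / k"
    using y_dense[of "x /\<^sub>R k" "e / k"] x k e by auto
  have "x - k *\<^sub>R y i = k *\<^sub>R (x /\<^sub>R k - y i)"
    using k by (simp add: scaleR_diff_right)
  then have "N (x - k *\<^sub>R y i) = k * N (x /\<^sub>R k - y i)"
    using x k by (simp only:) (subst N_scale, auto)
  also have "\<dots> < e"
    using i k by (simp add: field_simps)
  finally show ?thesis
    using k that by blast
qed

section \<open>Functionals and the dual norm\<close>

lemma dual_add: "f \<in> dual S N \<Longrightarrow> x \<in> S \<Longrightarrow> z \<in> S \<Longrightarrow> f (x + z) = f x + f z"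
  and dual_scale: "f \<in> dual S N \<Longrightarrow> x \<in> S \<Longrightarrow> f (c *\<^sub>R x) = c * f x"
  by (auto simp: dual_def)

lemma dual_diff: "f \<in> dual S N \<Longrightarrow> x \<in> S \<Longrightarrow> z \<in> S \<Longrightarrow> f (x - z) = f x - f z"
  using dual_add[of f "x - z" z] by simp

lemma dual_sum: "f \<in> dual S N \<Longrightarrow> f (\<Sum>i<n. c i *\<^sub>R y i) = (\<Sum>i<n. c i * f (y i))" for n :: nat
proof (induction n)
  case 0
  then show ?case
    using dual_scale[of f 0 0] by simp
next
  case (Suc n)
  then show ?case
    by (simp add: dual_add dual_scale)
qed

lemma dual_bounded:
  assumes "f \<in> dual S N"
  obtains C where "C > 0" "\<And>x. x \<in> S \<Longrightarrow> \<bar>f x\<bar> \<le> C * N x"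
proof -
  obtain C where C: "\<And>x. x \<in> S \<Longrightarrow> \<bar>f x\<bar> \<le> C * N x"
    using assms unfolding dual_def by blast
  have "\<bar>f x\<bar> \<le> (\<bar>C\<bar> + 1) * N x" if "x \<in> S" for x
    using C[OF that] N_nonneg[OF that] by (intro order_trans[OF C[OF that]] mult_right_mono) auto
  then show ?thesis
    by (intro that[of "\<bar>C\<bar> + 1"]) auto
qed

lemma dual_norm_upper:
  assumes f: "f \<in> dual S N" and x: "x \<in> S" "N x \<le> 1"
  shows "\<bar>f x\<bar> \<le> dual_norm S N f"
proof -
  obtain C where C: "C > 0" "\<And>x. x \<in> S \<Longrightarrow> \<bar>f x\<bar> \<le> C * N x"
    using dual_bounded[OF f] by blast
  have "bdd_above ((\<lambda>x. \<bar>f x\<bar>) ` {x \<in> S. N x \<le> 1})"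
    using C(2) mult_left_le[OF _ less_imp_le[OF C(1)]]
    by (intro bdd_aboveI2[of _ _ C]) (auto intro: order_trans)
  then show ?thesis
    unfolding dual_norm_def using x by (intro cSUP_upper) auto
qed

text \<open>A bounded functional changes little between a point of the ball and a nearby
  \<open>y i\<close>, so the supremum over the ball is one over a countable set. This is what makes
  dual norms visible in coordinates.\<close>

lemma dual_norm_le_iff:
  assumes f: "f \<in> dual S N"
  shows "dual_norm S N f \<le> e \<longleftrightarrow> (\<forall>i. \<bar>f (y i)\<bar> \<le> e)"
proof
  assume "dual_norm S N f \<le> e"
  then show "\<forall>i. \<bar>f (y i)\<bar> \<le> e"
    using dual_norm_upper[OF f y_in y_le] order_trans by blast
next
  assume e: "\<forall>i. \<bar>f (y i)\<bar> \<le> e"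
  obtain C where C: "C > 0" "\<And>x. x \<in> S \<Longrightarrow> \<bar>f x\<bar> \<le> C * N x"
    using dual_bounded[OF f] by blast
  show "dual_norm S N f \<le> e"
    unfolding dual_norm_def
  proof (rule cSUP_least)
    show "{x \<in> S. N x \<le> 1} \<noteq> {}"
      using y_in y_le by blast
    fix x assume x: "x \<in> {x \<in> S. N x \<le> 1}"
    show "\<bar>f x\<bar> \<le> e"
    proof (rule field_le_epsilon)
      fix d :: real assume d: "d > 0"
      then obtain i where "N (x - y i) < d / C"
        using y_dense[of x "d / C"] x C(1) by auto
      then have "C * N (x - y i) \<le> d"
        using C(1) by (simp add: field_simps)
      then have "\<bar>f x - f (y i)\<bar> \<le> d"
        using C(2)[of "x - y i"] x by (simp add: dual_diff[OF f])
      then show "\<bar>f x\<bar> \<le> e + d"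
        using e[rule_format, of i] by linarith
    qed
  qed
qed

lemma dual_norm_bound:
  assumes f: "f \<in> dual S N" and x: "x \<in> S"
  shows "\<bar>f x\<bar> \<le> dual_norm S N f * N x"
proof (cases "N x = 0")
  case True
  then show ?thesis
    using dual_bounded[OF f] x by (metis mult_zero_right)
next
  case False
  then have "N x > 0"
    using N_nonneg[OF x] by simp
  moreover have "\<bar>f (x /\<^sub>R N x)\<bar> \<le> dual_norm S N f"
    using x calculation by (intro dual_norm_upper[OF f]) (auto simp: N_scale)
  ultimately show ?thesis
    using x by (simp add: dual_scale[OF f] abs_mult field_simps)
qed

lemma dual_ball_iff: "f \<in> dual_ball S N \<longleftrightarrow> f \<in> dual S N \<and> (\<forall>x\<in>S. \<bar>f x\<bar> \<le> N x)"
proof safe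
  fix x assume "f \<in> dual_ball S N" "x \<in> S"
  then have "f \<in> dual S N" "dual_norm S N f \<le> 1"
    by (auto simp: dual_ball_def)
  then show "\<bar>f x\<bar> \<le> N x"
    using dual_norm_bound[of f x] mult_right_mono[of "dual_norm S N f" 1 "N x"]
      N_nonneg[OF \<open>x \<in> S\<close>] \<open>x \<in> S\<close> by simp
next
  assume f: "f \<in> dual S N" "\<forall>x\<in>S. \<bar>f x\<bar> \<le> N x"
  have "\<bar>f (y i)\<bar> \<le> 1" for i
    using f(2) y_in y_le order_trans by blast
  then show "f \<in> dual_ball S N"
    using f(1) by (simp add: dual_ball_def dual_norm_le_iff)
qed (simp add: dual_ball_def)

lemma dual_add_mem: "f \<in> dual S N \<Longrightarrow> h \<in> dual S N \<Longrightarrow> f + h \<in> dual S N"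
  and dual_diff_mem: "f \<in> dual S N \<Longrightarrow> h \<in> dual S N \<Longrightarrow> f - h \<in> dual S N"
  and dual_scale_mem: "f \<in> dual S N \<Longrightarrow> c *\<^sub>R f \<in> dual S N"
  using subspace_dual subspace_add subspace_diff subspace_scale by metis+

lemma dual_norm_add:
  assumes "f \<in> dual S N" "h \<in> dual S N"
  shows "dual_norm S N (f + h) \<le> dual_norm S N f + dual_norm S N h"
proof -
  have "\<bar>(f + h) (y i)\<bar> \<le> dual_norm S N f + dual_norm S N h" for i
    using dual_norm_upper[OF assms(1) y_in y_le, of i] dual_norm_upper[OF assms(2) y_in y_le, of i]
    unfolding plus_fun_apply by linarith
  then show ?thesis
    using assms by (simp add: dual_norm_le_iff dual_add_mem)
qed

lemma dual_norm_scale: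
  assumes f: "f \<in> dual S N"
  shows "dual_norm S N (c *\<^sub>R f) = \<bar>c\<bar> * dual_norm S N f"
proof -
  have le: "dual_norm S N (c *\<^sub>R f) \<le> \<bar>c\<bar> * dual_norm S N f" if f: "f \<in> dual S N" for c f
  proof -
    have "\<bar>(c *\<^sub>R f) (y i)\<bar> \<le> \<bar>c\<bar> * dual_norm S N f" for i
      using dual_norm_upper[OF f y_in y_le, of i]
      by (simp add: scaleR_fun_def abs_mult mult_left_mono)
    then show ?thesis
      using dual_norm_le_iff[OF dual_scale_mem[OF f]] by blast
  qed
  show ?thesis
  proof (cases "c = 0")
    case True
    have "dual_norm S N (0 :: 'a \<Rightarrow> real) = 0"
    proof -
      have "{x \<in> S. N x \<le> 1} \<noteq> {}"
        using y_in y_le by blast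
      then show ?thesis
        by (simp add: dual_norm_def)
    qed
    then show ?thesis
      using True by simp
  next
    case False
    have "dual_norm S N f \<le> \<bar>1 / c\<bar> * dual_norm S N (c *\<^sub>R f)"
      using le[of "c *\<^sub>R f" "1 / c"] f False by (simp add: dual_scale_mem)
    then show ?thesis
      using le[OF f, of c] False by (simp add: field_simps abs_mult)
  qed
qed

section \<open>Coordinates of functionals\<close>

definition code :: "('a \<Rightarrow> real) \<Rightarrow> nat \<Rightarrow> real" where
  "code f = (\<lambda>i. f (y i))"

text \<open>The image of the dual ball under \<open>code\<close>, by
  \<open>code_in_code_ball\<close> and \<open>code_surj\<close>. This description refers to the
  space only through norms of finite combinations, the quantities that will be known to be
  measurable.\<close>

definition code_ball :: "(nat \<Rightarrow> real) set" where
  "code_ball = {g. \<forall>n c. \<bar>\<Sum>i<n. c i * g i\<bar> \<le> N (\<Sum>i<n. c i *\<^sub>R y i)}"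

lemma code_in_code_ball: "f \<in> dual_ball S N \<Longrightarrow> code f \<in> code_ball"
  unfolding code_ball_def code_def by (auto simp: dual_ball_iff dual_sum[symmetric])

text \<open>The span of the pairs is the graph of the functional to be built. Using the graph avoids
  choosing coefficients when the \<open>y i\<close> are linearly dependent.\<close>

lemma span_pairs:
  assumes "(z, s) \<in> span (range (\<lambda>i. (y i, g i :: real)))"
  shows "\<exists>n c. z = (\<Sum>i<n. c i *\<^sub>R y i) \<and> s = (\<Sum>i<n. c i * g i)"
proof -
  define P where "P p \<longleftrightarrow> (\<exists>n c. p = (\<Sum>i<n. c i *\<^sub>R (y i, g i)))" for p
  have "P (z, s)"
    using assms
  proof (induction rule: span_induct_alt)
    case base
    show ?case
      unfolding P_def by (rule exI[of _ 0]) (simp add: zero_prod_def)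
  next
    case (step a p q)
    then obtain j n c where p: "p = (y j, g j)" and q: "q = (\<Sum>i<n. c i *\<^sub>R (y i, g i))"
      unfolding P_def by auto
    define m where "m = max n (Suc j)"
    define b where "b i = (if i < n then c i else 0) + (if i = j then a else 0)" for i
    have "(\<Sum>i<m. b i *\<^sub>R (y i, g i)) =
      (\<Sum>i<m. (if i < n then c i else 0) *\<^sub>R (y i, g i)) + (\<Sum>i<m. (if i = j then a else 0) *\<^sub>R (y i, g i))"
      unfolding b_def by (simp only: scaleR_add_left sum.distrib)
    also have "(\<Sum>i<m. (if i < n then c i else 0) *\<^sub>R (y i, g i)) = q"
      unfolding q by (rule sum.mono_neutral_cong_right) (auto simp: m_def zero_prod_def)
    also have "(\<Sum>i<m. (if i = j then a else 0) *\<^sub>R (y i, g i)) = (\<Sum>i\<in>{j}. a *\<^sub>R (y i, g i))"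
      by (rule sum.mono_neutral_cong_right) (auto simp: m_def zero_prod_def)
    finally show ?case
      unfolding P_def p by (intro exI[of _ m] exI[of _ b]) (simp add: add.commute)
  qed
  then obtain n c where "(z, s) = (\<Sum>i<n. c i *\<^sub>R (y i, g i))"
    unfolding P_def by blast
  then show ?thesis
    by (intro exI[of _ n] exI[of _ c]) (simp add: prod_eq_iff fst_sum snd_sum)
qed

text \<open>
  The functional is first defined on the combinations of the \<open>y i\<close>, where it is bounded by \<open>N\<close>;
  its value at \<open>x\<close> is the only number within \<open>N (x - z)\<close> of its values at all these \<open>z\<close>.
\<close>

lemma code_surj:
  assumes g: "g \<in> code_ball"
  obtains f where "f \<in> dual_ball S N" "code f = g"
proof -
  define Z where "Z = span (range (\<lambda>i. (y i, g i)))"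
  have sub: "subspace Z"
    by (simp add: Z_def)
  have Z: "z \<in> S" "\<bar>s\<bar> \<le> N z" if zs: "(z, s) \<in> Z" for z s
  proof -
    obtain n c where nc: "z = (\<Sum>i<n. c i *\<^sub>R y i)" "s = (\<Sum>i<n. c i * g i)"
      using zs span_pairs unfolding Z_def by blast
    show "z \<in> S" "\<bar>s\<bar> \<le> N z"
      using g unfolding nc code_ball_def by auto
  qed
  have dense: "\<exists>z s. (z, s) \<in> Z \<and> N (x - z) < e" if xe: "x \<in> S" "e > 0" for x e
  proof -
    obtain k i where "k > 0" "N (x - k *\<^sub>R y i) < e"
      using scaled_dense[OF xe] by blast
    moreover have "k *\<^sub>R (y i, g i) \<in> Z"
      using sub by (intro subspace_scale) (auto simp: Z_def span_base)
    ultimately show ?thesis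
      by auto
  qed
  have diffZ: "(z - z', s - s') \<in> Z" and addZ: "(z + z', s + s') \<in> Z"
    if "(z, s) \<in> Z" "(z', s') \<in> Z" for z s z' s'
    using subspace_diff[OF sub that] subspace_add[OF sub that] by auto
  have "\<exists>t. \<forall>z s. (z, s) \<in> Z \<longrightarrow> \<bar>t - s\<bar> \<le> N (x - z)" if x: "x \<in> S" for x
  proof -
    have le: "s - N (x - z) \<le> s' + N (x - z')" if "(z, s) \<in> Z" "(z', s') \<in> Z" for z s z' s'
    proof -
      have "\<bar>s - s'\<bar> \<le> N (z - z')" "z \<in> S" "z' \<in> S"
        using that Z diffZ by blast+
      then show ?thesis
        using N_diff_triangle[of z x z'] N_diff_commute[of z x] x by simp
    qed
    \<comment> \<open>Any number between all lower bounds \<open>s - N (x - z)\<close> and all upper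
      bounds \<open>s' + N (x - z')\<close> will do, as in the one-step Hahn-Banach extension.
      Additivity and homogeneity of \<open>F\<close> then follow from density.\<close>
    define L where "L = (\<lambda>(z, s). s - N (x - z)) ` Z"
    have ne: "Z \<noteq> {}"
      using subspace_0[OF sub] by blast
    have bdd: "bdd_above L"
      using le ne unfolding L_def by (fastforce intro: bdd_aboveI2)
    have "s - N (x - z) \<le> Sup L" if "(z, s) \<in> Z" for z s
      using bdd that by (intro cSup_upper) (auto simp: L_def image_iff intro!: bexI[of _ "(z, s)"])
    moreover have "Sup L \<le> s + N (x - z)" if "(z, s) \<in> Z" for z s
      using ne le that by (intro cSup_least) (auto simp: L_def)
    ultimately show ?thesis
      by (intro exI[of _ "Sup L"]) (auto simp: abs_le_iff algebra_simps)
  qed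
  then obtain F where F: "\<And>x z s. x \<in> S \<Longrightarrow> (z, s) \<in> Z \<Longrightarrow> \<bar>F x - s\<bar> \<le> N (x - z)"
    by metis
  have add: "F (x + x') = F x + F x'" if x: "x \<in> S" "x' \<in> S" for x x'
  proof -
    have "\<bar>F (x + x') - (F x + F x')\<bar> \<le> 0"
    proof (rule field_le_epsilon)
      fix d :: real assume "d > 0"
      then obtain z s z' s' where zs: "(z, s) \<in> Z" "N (x - z) < d / 4" "(z', s') \<in> Z" "N (x' - z') < d / 4"
        using dense[of x "d / 4"] dense[of x' "d / 4"] x by auto
      have "\<bar>F (x + x') - (s + s')\<bar> \<le> N (x + x' - (z + z'))"
        using x addZ[OF zs(1,3)] by (intro F) auto
      also have "\<dots> \<le> N (x - z) + N (x' - z')"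
        using N_add[of "x - z" "x' - z'"] x Z(1)[OF zs(1)] Z(1)[OF zs(3)] by (simp add: algebra_simps)
      finally show "\<bar>F (x + x') - (F x + F x')\<bar> \<le> 0 + d"
        using F[OF x(1) zs(1)] F[OF x(2) zs(3)] zs(2,4) by linarith
    qed
    then show ?thesis by simp
  qed
  have scale: "F (c *\<^sub>R x) = c * F x" if x: "x \<in> S" for c x
  proof -
    have "\<bar>F (c *\<^sub>R x) - c * F x\<bar> \<le> 0"
    proof (rule field_le_epsilon)
      fix d :: real assume d: "d > 0"
      \<comment> \<open>Replacing \<open>x\<close> by \<open>z\<close> causes two errors, each at
        most \<open>\<bar>c\<bar> * N (x - z)\<close>; the added 1 keeps \<open>k\<close> positive
        for \<open>c = 0\<close>.\<close>
      define k where "k = 2 * (\<bar>c\<bar> + 1)"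
      have k: "k > 0" "2 * \<bar>c\<bar> \<le> k"
        by (auto simp: k_def)
      obtain z s where zs: "(z, s) \<in> Z" "N (x - z) < d / k"
        using dense[of x "d / k"] x d k by auto
      have "\<bar>F (c *\<^sub>R x) - c * s\<bar> \<le> N (c *\<^sub>R x - c *\<^sub>R z)"
        using x subspace_scale[OF sub zs(1), of c] by (intro F) auto
      also have "\<dots> = \<bar>c\<bar> * N (x - z)"
        using x Z(1)[OF zs(1)] by (simp add: N_scale flip: scaleR_diff_right)
      finally have 1: "\<bar>F (c *\<^sub>R x) - c * s\<bar> \<le> \<bar>c\<bar> * N (x - z)" .
      have "\<bar>c * F x - c * s\<bar> \<le> \<bar>c\<bar> * N (x - z)"
        using F[OF x zs(1)] by (simp add: abs_mult mult_left_mono flip: right_diff_distrib)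
      then have "\<bar>F (c *\<^sub>R x) - c * F x\<bar> \<le> 2 * \<bar>c\<bar> * N (x - z)"
        using 1 by linarith
      also have "\<dots> \<le> k * N (x - z)"
        using k x Z(1)[OF zs(1)] by (intro mult_right_mono N_nonneg) auto
      also have "\<dots> \<le> d"
        using zs(2) k by (simp add: field_simps)
      finally show "\<bar>F (c *\<^sub>R x) - c * F x\<bar> \<le> 0 + d"
        by simp
    qed
    then show ?thesis by simp
  qed
  have bound: "\<bar>F x\<bar> \<le> N x" if "x \<in> S" for x
    using F[OF that, of 0 0] subspace_0[OF sub] by (simp flip: zero_prod_def)
  have Fy: "F (y i) = g i" for i
  proof -
    have "(y i, g i) \<in> Z"
      by (simp add: Z_def span_base)
    then show ?thesis
      using F[of "y i" "y i" "g i"] by simp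
  qed
  define f where "f x = (if x \<in> S then F x else 0)" for x
  have "f \<in> dual S N"
    using add scale bound by (auto simp: dual_def f_def intro!: exI[of _ 1])
  then have "f \<in> dual_ball S N"
    using bound by (auto simp: dual_ball_iff f_def)
  moreover have "code f = g"
    using Fy by (auto simp: code_def f_def)
  ultimately show ?thesis
    using that by blast
qed

lemma dual_norm_diff_le_iff:
  "f \<in> dual S N \<Longrightarrow> h \<in> dual S N \<Longrightarrow> dual_norm S N (f - h) \<le> e \<longleftrightarrow> (\<forall>i. \<bar>code f i - code h i\<bar> \<le> e)"
  by (simp add: dual_norm_le_iff dual_diff_mem code_def)

text \<open>Members of the dual ball satisfy a common Lipschitz bound, so convergence at the
  \<open>y i\<close> spreads to all of \<open>S\<close> by approximating \<open>x\<close> with a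
  multiple of some \<open>y i\<close>.\<close>

lemma weak_star_lim_codeI:
  assumes u: "\<And>n. u n \<in> dual_ball S N" and f: "f \<in> dual_ball S N"
    and lim: "\<And>i. (\<lambda>n. code (u n) i) \<longlonglongrightarrow> code f i"
  shows "weak_star_lim S u f"
  unfolding weak_star_lim_def
proof
  fix x assume x: "x \<in> S"
  show "(\<lambda>n. u n x) \<longlonglongrightarrow> f x"
  proof (rule LIMSEQ_I)
    fix e :: real assume e: "e > 0"
    obtain k i where ki: "k > 0" "N (x - k *\<^sub>R y i) < e / 3"
      using scaled_dense[OF x, of "e / 3"] e by auto
    obtain n\<^sub>0 where n\<^sub>0: "\<And>n. n \<ge> n\<^sub>0 \<Longrightarrow> \<bar>code (u n) i - code f i\<bar> < e / (3 * k)"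
      using LIMSEQ_D[OF lim[of i], of "e / (3 * k)"] e ki(1) by auto
    have close: "\<bar>h x - k * code h i\<bar> < e / 3" if "h \<in> dual_ball S N" for h
    proof -
      have h: "h \<in> dual S N" "\<bar>h (x - k *\<^sub>R y i)\<bar> \<le> N (x - k *\<^sub>R y i)"
        using that x by (simp_all add: dual_ball_iff)
      have "h (x - k *\<^sub>R y i) = h x - k * code h i"
        using x by (simp add: dual_diff[OF h(1)] dual_scale[OF h(1)] code_def)
      then show ?thesis
        using h(2) ki(2) by linarith
    qed
    have "\<bar>u n x - f x\<bar> < e" if "n \<ge> n\<^sub>0" for n
    proof -
      have "\<bar>k * code (u n) i - k * code f i\<bar> < e / 3"
      proof -
        have "\<bar>k * code (u n) i - k * code f i\<bar> = k * \<bar>code (u n) i - code f i\<bar>"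
          using ki(1) by (simp add: abs_mult flip: right_diff_distrib)
        also have "\<dots> < k * (e / (3 * k))"
          using n\<^sub>0[OF that] ki(1) by (rule mult_strict_left_mono)
        finally show ?thesis
          using ki(1) by simp
      qed
      then show ?thesis
        using close[OF u[of n]] close[OF f] by linarith
    qed
    then show "\<exists>no. \<forall>n\<ge>no. norm (u n x - f x) < e"
      unfolding real_norm_def by blast
  qed
qed

lemma dual_ball_weak_star_closed:
  assumes u: "\<And>n. u n \<in> dual_ball S N" and f: "f \<in> dual S N" and lim: "weak_star_lim S u f"
  shows "f \<in> dual_ball S N"
proof -
  have "\<bar>f x\<bar> \<le> N x" if x: "x \<in> S" for x
  proof (rule LIMSEQ_le_const2)
    show "(\<lambda>n. \<bar>u n x\<bar>) \<longlonglongrightarrow> \<bar>f x\<bar>"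
      using lim x by (auto simp: weak_star_lim_def intro: tendsto_rabs)
    show "\<exists>n\<^sub>0. \<forall>n\<ge>n\<^sub>0. \<bar>u n x\<bar> \<le> N x"
      using u[unfolded dual_ball_iff] x by blast
  qed
  then show ?thesis
    using f by (simp add: dual_ball_iff)
qed

end

lemma tendsto_fun_iff:
  fixes f :: "'b \<Rightarrow> 'i \<Rightarrow> 'c::topological_space"
  shows "(f \<longlongrightarrow> g) F \<longleftrightarrow> (\<forall>i. ((\<lambda>n. f n i) \<longlongrightarrow> g i) F)"
  using limitin_componentwise[of "\<lambda>_. euclidean" UNIV f g F]
  by (simp add: euclidean_product_topology)

context coded_space
begin

section \<open>Countably many constraints describing the coded ball\<close>

lemma N_sum_le: "N (\<Sum>i<n. c i *\<^sub>R y i) \<le> (\<Sum>i<n. \<bar>c i\<bar>)" for n :: nat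
proof (induction n)
  case (Suc n)
  have "N (\<Sum>i<Suc n. c i *\<^sub>R y i) \<le> N (\<Sum>i<n. c i *\<^sub>R y i) + \<bar>c n\<bar> * N (y n)"
    using N_add[of "\<Sum>i<n. c i *\<^sub>R y i" "c n *\<^sub>R y n"] by (simp add: N_scale)
  also have "\<dots> \<le> (\<Sum>i<n. \<bar>c i\<bar>) + \<bar>c n\<bar>"
    using Suc y_le[of n] by (intro add_mono) (auto simp: mult_left_le)
  finally show ?case by simp
qed simp

lemma code_ball_cube: "g \<in> code_ball \<Longrightarrow> \<bar>g i\<bar> \<le> 1"
proof -
  assume g: "g \<in> code_ball"
  define c where "c j = (if j = i then 1 else 0 :: real)" for j
  have "\<bar>\<Sum>j<Suc i. c j * g j\<bar> \<le> N (\<Sum>j<Suc i. c j *\<^sub>R y j)"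
    using g unfolding code_ball_def by blast
  then show ?thesis
    using y_le[of i] by (simp add: c_def)
qed

lemma zero_in_code_ball: "(\<lambda>_. 0) \<in> code_ball"
  by (auto simp: code_ball_def N_nonneg)

text \<open>The form required by \<open>hit_measurable_constraints\<close>: a fixed compact cube and
  countably many bounds. The cube comes from testing single coordinates, and rational coefficients
  suffice by approximation.\<close>

lemma code_ball_eq:
  "code_ball = {g \<in> {g. \<forall>i. \<bar>g i\<bar> \<le> 1}. \<forall>q :: rat list.
     \<bar>\<Sum>i<length q. of_rat (q ! i) * g i\<bar> \<le> N (\<Sum>i<length q. of_rat (q ! i) *\<^sub>R y i)}"
proof (intro equalityI subsetI)
  fix g assume "g \<in> code_ball"
  then show "g \<in> {g \<in> {g. \<forall>i. \<bar>g i\<bar> \<le> 1}. \<forall>q :: rat list.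
     \<bar>\<Sum>i<length q. of_rat (q ! i) * g i\<bar> \<le> N (\<Sum>i<length q. of_rat (q ! i) *\<^sub>R y i)}"
    using code_ball_cube by (auto simp: code_ball_def)
next
  fix g assume "g \<in> {g \<in> {g. \<forall>i. \<bar>g i\<bar> \<le> 1}. \<forall>q :: rat list.
     \<bar>\<Sum>i<length q. of_rat (q ! i) * g i\<bar> \<le> N (\<Sum>i<length q. of_rat (q ! i) *\<^sub>R y i)}"
  then have g1: "\<bar>g i\<bar> \<le> 1"
    and gq: "\<bar>\<Sum>i<length q. of_rat (q ! i) * g i\<bar> \<le> N (\<Sum>i<length q. of_rat (q ! i) *\<^sub>R y i)"
    for i and q :: "rat list"
    by blast+
  have "\<bar>\<Sum>i<n. c i * g i\<bar> \<le> N (\<Sum>i<n. c i *\<^sub>R y i)" for n and c :: "nat \<Rightarrow> real"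
  proof (rule field_le_epsilon)
    fix e :: real assume e: "e > 0"
    \<comment> \<open>Rounding \<open>n\<close> coefficients by less than \<open>d\<close> costs at
      most \<open>n * d\<close> on either side, since \<open>\<bar>g i\<bar> \<le> 1\<close> and
      \<open>N (y i) \<le> 1\<close>. The total is at most \<open>e\<close>, and adding 1 covers
      \<open>n = 0\<close>.\<close>
    define d where "d = e / (2 * (real n + 1))"
    have d: "d > 0" "2 * (real n * d) \<le> e"
      using e by (auto simp: d_def field_simps)
    have "\<exists>q. \<bar>c i - of_rat q\<bar> < d" for i
    proof -
      obtain q where "c i - d < of_rat q" "of_rat q < c i"
        using of_rat_dense[of "c i - d" "c i"] d by auto
      then show ?thesis
        by (intro exI[of _ q]) auto
    qed
    then obtain p where p: "\<And>i. \<bar>c i - of_rat (p i)\<bar> < d"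
      by metis
    define q where "q = map p [0..<n]"
    have q: "length q = n" "\<And>i. i < n \<Longrightarrow> q ! i = p i"
      by (auto simp: q_def)
    have bound: "(\<Sum>i<n. \<bar>c i - of_rat (p i)\<bar>) \<le> real n * d"
      using sum_bounded_above[of "{..<n}" "\<lambda>i. \<bar>c i - of_rat (p i)\<bar>" d] p by (auto simp: less_imp_le)
    have "(\<lambda>i. \<bar>of_rat (p i) - c i\<bar>) = (\<lambda>i. \<bar>c i - of_rat (p i)\<bar>)"
      by (rule ext) (rule abs_minus_commute)
    then have bound': "(\<Sum>i<n. \<bar>of_rat (p i) - c i\<bar>) \<le> real n * d"
      using bound by metis
    have "\<bar>\<Sum>i<n. (c i - of_rat (p i)) * g i\<bar> \<le> (\<Sum>i<n. \<bar>(c i - of_rat (p i)) * g i\<bar>)"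
      by (rule sum_abs)
    also have "\<dots> \<le> (\<Sum>i<n. \<bar>c i - of_rat (p i)\<bar>)"
      using g1 by (intro sum_mono) (simp add: abs_mult mult_left_le)
    finally have 1: "\<bar>\<Sum>i<n. (c i - of_rat (p i)) * g i\<bar> \<le> real n * d"
      using bound by linarith
    have 2: "\<bar>\<Sum>i<n. of_rat (p i) * g i\<bar> \<le> N (\<Sum>i<n. of_rat (p i) *\<^sub>R y i)"
      using gq[of q] q by simp
    have "(\<Sum>i<n. of_rat (p i) *\<^sub>R y i) = (\<Sum>i<n. c i *\<^sub>R y i) + (\<Sum>i<n. (of_rat (p i) - c i) *\<^sub>R y i)"
      by (simp add: scaleR_diff_left sum_subtractf)
    then have "N (\<Sum>i<n. of_rat (p i) *\<^sub>R y i) \<le>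
        N (\<Sum>i<n. c i *\<^sub>R y i) + N (\<Sum>i<n. (of_rat (p i) - c i) *\<^sub>R y i)"
      by (simp only: N_add[OF sum_in_S sum_in_S])
    moreover have "N (\<Sum>i<n. (of_rat (p i) - c i) *\<^sub>R y i) \<le> real n * d"
      by (rule order_trans[OF N_sum_le bound'])
    ultimately have 3: "N (\<Sum>i<n. of_rat (p i) *\<^sub>R y i) \<le> N (\<Sum>i<n. c i *\<^sub>R y i) + real n * d"
      by linarith
    have "(\<Sum>i<n. c i * g i) = (\<Sum>i<n. of_rat (p i) * g i) + (\<Sum>i<n. (c i - of_rat (p i)) * g i)"
      by (simp add: left_diff_distrib sum_subtractf)
    then show "\<bar>\<Sum>i<n. c i * g i\<bar> \<le> N (\<Sum>i<n. c i *\<^sub>R y i) + e"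
      using 1 2 3 d(2) by linarith
  qed
  then show "g \<in> code_ball"
    by (simp add: code_ball_def)
qed

end

lemma compact_cube: "compact {g :: nat \<Rightarrow> real. \<forall>i. \<bar>g i\<bar> \<le> 1}"
proof -
  have "{g :: nat \<Rightarrow> real. \<forall>i. \<bar>g i\<bar> \<le> 1} = PiE UNIV (\<lambda>_. {-1..1})"
    by (auto simp: PiE_def abs_le_iff Pi_iff minus_le_iff)
  moreover have "compactin (product_topology (\<lambda>_. euclidean) UNIV) (PiE UNIV (\<lambda>_ :: nat. {-1..1 :: real}))"
    by (simp add: compactin_PiE)
  ultimately show ?thesis
    by (simp add: euclidean_product_topology)
qed

lemma continuous_on_abs_coord_sum:
  "continuous_on UNIV (\<lambda>g :: nat \<Rightarrow> real. \<bar>\<Sum>i<n. c i * g i\<bar>)" for n :: nat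
  by (intro continuous_on_rabs continuous_on_sum continuous_on_mult continuous_on_const
      continuous_on_product_coordinates)

lemma hit_measurable_cong:
  assumes "\<And>\<omega>. \<omega> \<in> space M \<Longrightarrow> K \<omega> = L \<omega>" "hit_measurable M K"
  shows "hit_measurable M L"
proof -
  have "Measurable.pred M (\<lambda>\<omega>. L \<omega> \<inter> C \<noteq> {})" if "closed C" for C
    using hit_measurable_pred[OF assms(2) that] assms(1)
    by (subst measurable_cong[where g = "\<lambda>\<omega>. K \<omega> \<inter> C \<noteq> {}"]) auto
  then show ?thesis
    using assms by (auto simp: hit_measurable_def)
qed

lemma osucc_less_omega1: "a < omega1 \<Longrightarrow> osucc a < omega1"
proof -
  assume "a < omega1"
  moreover have "{..<osucc a} \<subseteq> insert a {..<a}"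
    by (auto simp: not_less) (metis antisym not_le osucc_le_iff)
  ultimately show ?thesis
    by (metis countable_insert countable_subset less_omega1_iff)
qed

section \<open>Compactness of the coded ball and comparison of the two derivatives\<close>

context coded_space
begin

text \<open>Over a one-point parameter space the norm bounds are constants, so the compactness
  contained in \<open>hit_measurable\<close> applies to a single space.\<close>

lemma compact_code_ball: "compact code_ball"
proof -
  have "hit_measurable (count_space UNIV) (\<lambda>_ :: unit. {g \<in> {g. \<forall>i. \<bar>g i\<bar> \<le> 1}. \<forall>q :: rat list.
     \<bar>\<Sum>i<length q. of_rat (q ! i) * g i\<bar> \<le> N (\<Sum>i<length q. of_rat (q ! i) *\<^sub>R y i)})"
    by (intro hit_measurable_constraints compact_cube continuous_on_abs_coord_sum) simp
  then show ?thesis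
    unfolding code_ball_eq by (rule hit_measurable_compact) simp
qed

text \<open>If \<open>f\<close> is a weak* limit of functionals more than \<open>e\<close> away from
  it, every neighbourhood of \<open>code f\<close> contains one of their codes as well as
  \<open>code f\<close>, so it is not small. That \<open>code f\<close> itself belongs to the stage
  uses closedness of the stage.\<close>

lemma szlenk_iterate_imp_sz_iter:
  "f \<in> szlenk_iterate S N e (dual_ball S N) a \<Longrightarrow> f \<in> dual_ball S N \<and> code f \<in> sz_iter e code_ball a"
proof (induction a arbitrary: f rule: ordinal_limit_induct)
  case zero
  then have "f \<in> dual_ball S N"
    unfolding szlenk_iterate_def ord_rec_0 .
  then show ?case
    using code_in_code_ball by simp
next
  case (osucc a)
  let ?L = "sz_iter e code_ball a"
  obtain u where u: "\<And>n. u n \<in> szlenk_iterate S N e (dual_ball S N) a"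
    and f: "f \<in> dual S N" and lim: "weak_star_lim S u f"
    and far: "\<And>n. dual_norm S N (u n - f) > e"
    using osucc.prems by (auto simp: szlenk_iterate_def ord_rec_osucc szlenk_derivative_def)
  have ub: "u n \<in> dual_ball S N" "code (u n) \<in> ?L" for n
    using osucc.IH[OF u] by auto
  have fb: "f \<in> dual_ball S N"
    using ub(1) f lim by (rule dual_ball_weak_star_closed)
  have tends: "(\<lambda>n. code (u n)) \<longlonglongrightarrow> code f"
    using lim by (auto simp: tendsto_fun_iff code_def weak_star_lim_def)
  have "closed ?L"
    by (intro compact_imp_closed compact_sz_iter compact_code_ball)
  then have fL: "code f \<in> ?L"
    using ub(2) tends by (rule closed_sequentially)
  have "\<not> coord_small e (?L \<inter> U)" if U: "open U" "code f \<in> U" for U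
  proof
    assume small: "coord_small e (?L \<inter> U)"
    obtain n where n: "code (u n) \<in> U"
      using topological_tendstoD[OF tends U] by (auto simp: eventually_sequentially)
    have "dual_norm S N (u n - f) \<le> e"
      using small n U ub fL f by (subst dual_norm_diff_le_iff) (auto simp: dual_ball_def coord_small_def)
    then show False
      using far[of n] by simp
  qed
  then show ?case
    using fb fL by (simp add: sz_deriv_def)
next
  case (limit a)
  have "0 < a"
    using limit(1) by (metis order_le_less zero_le_ordinal)
  have "f \<in> szlenk_iterate S N e (dual_ball S N) b" if "b < a" for b
    using limit.prems limit.hyps that by (simp add: szlenk_iterate_def ord_rec_limit)
  then show ?case
    using limit.IH \<open>0 < a\<close> limit.hyps by (auto simp: sz_iter_limit)
qed

text \<open>A ball around \<open>code f\<close> of radius 1/(n+1) meets the stage in two points more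
  than \<open>2 * e\<close> apart, one of which is more than \<open>e\<close> away from
  \<open>code f\<close>. These points, lifted by \<open>code_surj\<close>, form the required
  sequence.\<close>

lemma sz_iter_imp_szlenk_iterate:
  "f \<in> dual_ball S N \<Longrightarrow> code f \<in> sz_iter (2 * e) code_ball a \<Longrightarrow>
     f \<in> szlenk_iterate S N e (dual_ball S N) a"
proof (induction a arbitrary: f rule: ordinal_limit_induct)
  case zero
  then show ?case
    unfolding szlenk_iterate_def ord_rec_0 by simp
next
  case (osucc a)
  let ?L = "sz_iter (2 * e) code_ball a"
  have f: "f \<in> dual S N"
    using osucc.prems by (simp add: dual_ball_def)
  have "\<exists>v. v \<in> dual_ball S N \<and> code v \<in> ?L \<and> dist (code v) (code f) < 1 / Suc n \<and>
      dual_norm S N (v - f) > e" for n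
  proof -
    have "\<not> coord_small (2 * e) (?L \<inter> ball (code f) (1 / Suc n))"
      using osucc.prems by (auto simp: sz_deriv_def)
    then obtain g h i where gh: "g \<in> ?L \<inter> ball (code f) (1 / Suc n)"
      "h \<in> ?L \<inter> ball (code f) (1 / Suc n)" "\<bar>g i - h i\<bar> > 2 * e"
      unfolding coord_small_def by (meson not_le)
    then have "\<bar>g i - code f i\<bar> > e \<or> \<bar>h i - code f i\<bar> > e"
      by linarith
    then obtain w where w: "w \<in> ?L" "dist (code f) w < 1 / Suc n" "\<bar>w i - code f i\<bar> > e"
      using gh by auto
    have "w \<in> code_ball"
      using w(1) sz_iter_antimono[of 0 a "2 * e" code_ball] by auto
    then obtain v where v: "v \<in> dual_ball S N" "code v = w"
      by (rule code_surj)
    moreover have "dual_norm S N (v - f) > e"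
      using dual_norm_diff_le_iff[of v f e] v w(3) f by (auto simp: dual_ball_def not_le[symmetric])
    ultimately show ?thesis
      using w by (auto simp: dist_commute)
  qed
  then obtain v where v: "\<And>n. v n \<in> dual_ball S N" "\<And>n. code (v n) \<in> ?L"
    "\<And>n. dist (code (v n)) (code f) < 1 / Suc n" "\<And>n. dual_norm S N (v n - f) > e"
    by metis
  have "(\<lambda>n. dist (code (v n)) (code f)) \<longlonglongrightarrow> 0"
  proof (rule tendsto_sandwich[where f = "\<lambda>_. 0" and h = "\<lambda>n. 1 / real (Suc n)"])
    show "\<forall>\<^sub>F n in sequentially. dist (code (v n)) (code f) \<le> 1 / real (Suc n)"
      using v(3) by (intro always_eventually allI less_imp_le)
    show "(\<lambda>n. 1 / real (Suc n)) \<longlonglongrightarrow> 0"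
      by (rule LIMSEQ_Suc[OF lim_inverse_n'])
  qed simp_all
  then have "(\<lambda>n. code (v n)) \<longlonglongrightarrow> code f"
    by (rule tendsto_dist_iff[THEN iffD2])
  then have "weak_star_lim S v f"
    using v(1) osucc.prems(1) unfolding tendsto_fun_iff by (intro weak_star_lim_codeI) blast+
  moreover have "range v \<subseteq> szlenk_iterate S N e (dual_ball S N) a"
    using osucc.IH v by blast
  ultimately show ?case
    using f v(4) unfolding szlenk_iterate_def ord_rec_osucc szlenk_derivative_def by blast
next
  case (limit a)
  then have "f \<in> szlenk_iterate S N e (dual_ball S N) b" if "b < a" for b
    using that sz_iter_antimono[of b a "2 * e" code_ball] by (auto simp: less_imp_le)
  then show ?case
    using limit.hyps by (simp add: szlenk_iterate_def ord_rec_limit)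
qed

lemma zero_in_dual_ball: "0 \<in> dual_ball S N"
  using subspace_0[OF subspace_dual] by (auto simp: dual_ball_iff N_nonneg)

text \<open>Suprema of ordinals are only conditionally complete here. The sets involved are nonempty
  because the zero functional lies in stage 0, and they are bounded by
  \<open>omega1\<close>.\<close>

lemma szlenk_index_le_iff_iterate:
  "szlenk_index S N \<le> \<alpha> \<longleftrightarrow> (\<forall>e>0. \<forall>a<omega1. szlenk_iterate S N e (dual_ball S N) a \<noteq> {} \<longrightarrow> a \<le> \<alpha>)"
proof -
  define A where "A e = {a. a < omega1 \<and> szlenk_iterate S N e (dual_ball S N) a \<noteq> {}}" for e
  have "countable {..<0 :: ordinal}"
    by (metis countable_empty equals0I lessThan_iff not_le zero_le_ordinal)
  then have 0: "0 \<in> A e" for e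
    using zero_in_dual_ball by (auto simp: A_def szlenk_iterate_def ord_rec_0 less_omega1_iff)
  have bdd: "bdd_above (A e)" for e
    by (rule bdd_aboveI[of _ omega1]) (auto simp: A_def)
  have ne: "A e \<noteq> {}" for e
    using 0 by blast
  then have "Sup (A e) \<le> omega1" for e
    by (rule cSup_least) (auto simp: A_def)
  then have bdd': "bdd_above ((\<lambda>e. Sup (A e)) ` {0<..})"
    by (intro bdd_aboveI2[where M = omega1])
  have "szlenk_index S N = (SUP e\<in>{0<..}. Sup (A e))"
    by (simp add: szlenk_index_def A_def)
  also have "\<dots> \<le> \<alpha> \<longleftrightarrow> (\<forall>e>0. Sup (A e) \<le> \<alpha>)"
    using bdd' by (subst cSUP_le_iff) auto
  also have "\<dots> \<longleftrightarrow> (\<forall>e>0. \<forall>a\<in>A e. a \<le> \<alpha>)"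
    by (simp only: cSup_le_iff[OF ne bdd])
  finally show ?thesis
    unfolding A_def by blast
qed

text \<open>Since \<alpha> is countable, \<open>osucc \<alpha>\<close> still lies below
  \<open>omega1\<close> and counts towards the index, so nonemptiness there violates the bound.
  Stages shrink in the ordinal and in \<open>e\<close>, hence this one stage and the values 1/(m+1)
  decide everything.\<close>

lemma szlenk_index_le_iff:
  assumes \<alpha>: "\<alpha> < omega1"
  shows "szlenk_index S N \<le> \<alpha> \<longleftrightarrow> (\<forall>m :: nat. sz_iter (1 / Suc m) code_ball (osucc \<alpha>) = {})"
  unfolding szlenk_index_le_iff_iterate
proof (intro iffI allI impI equals0I)
  fix m g
  assume *: "\<forall>e>0. \<forall>a<omega1. szlenk_iterate S N e (dual_ball S N) a \<noteq> {} \<longrightarrow> a \<le> \<alpha>"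
    and g: "g \<in> sz_iter (1 / Suc m) code_ball (osucc \<alpha>)"
  \<comment> \<open>Half of 1/(m+1), to compensate for the factor 2 in
    \<open>sz_iter_imp_szlenk_iterate\<close>.\<close>
  define e :: real where "e = 1 / (2 * Suc m)"
  have e: "e > 0" "2 * e = 1 / Suc m"
    by (auto simp: e_def field_simps)
  have "g \<in> code_ball"
    using g sz_iter_antimono[of 0 "osucc \<alpha>" "1 / Suc m" code_ball] by auto
  then obtain f where f: "f \<in> dual_ball S N" "code f = g"
    by (rule code_surj)
  have "f \<in> szlenk_iterate S N e (dual_ball S N) (osucc \<alpha>)"
    using f g e by (intro sz_iter_imp_szlenk_iterate) auto
  then have "osucc \<alpha> \<le> \<alpha>"
    using * e(1) osucc_less_omega1[OF \<alpha>] by blast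
  then show False
    using less_osucc[of \<alpha>] by simp
next
  fix e :: real and a
  assume *: "\<forall>m :: nat. sz_iter (1 / Suc m) code_ball (osucc \<alpha>) = {}" and e: "e > 0"
    and "szlenk_iterate S N e (dual_ball S N) a \<noteq> {}"
  then obtain f where f: "f \<in> szlenk_iterate S N e (dual_ball S N) a"
    by blast
  show "a \<le> \<alpha>"
  proof (rule ccontr)
    assume "\<not> a \<le> \<alpha>"
    then have a: "osucc \<alpha> \<le> a"
      by (simp add: osucc_le_iff)
    obtain m :: nat where m: "1 / Suc m < e"
      using reals_Archimedean[OF e] by (auto simp: inverse_eq_divide)
    have "code f \<in> sz_iter e code_ball a"
      using szlenk_iterate_imp_sz_iter[OF f] by simp
    also have "\<dots> \<subseteq> sz_iter e code_ball (osucc \<alpha>)"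
      using a by (rule sz_iter_antimono)
    also have "\<dots> \<subseteq> sz_iter (1 / Suc m) code_ball (osucc \<alpha>)"
      using m by (intro sz_iter_antimono_eps) auto
    finally show False
      using * by simp
  qed
qed

end

section \<open>Measurable families of coded spaces\<close>

lemma hit_measurable_Int:
  assumes K: "hit_measurable M K" and D: "closed (D :: 'b::t2_space set)"
  shows "hit_measurable M (\<lambda>\<omega>. K \<omega> \<inter> D)"
  unfolding hit_measurable_def
proof (intro conjI ballI allI impI)
  show "compact (K \<omega> \<inter> D)" if "\<omega> \<in> space M" for \<omega>
    using hit_measurable_compact[OF K that] D by (rule compact_Int_closed)
  show "Measurable.pred M (\<lambda>\<omega>. K \<omega> \<inter> D \<inter> C \<noteq> {})" if "closed C" for C
    using hit_measurable_pred[OF K closed_Int[OF D that]] by (simp add: Int_assoc)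
qed

lemma hit_measurable_If:
  assumes [measurable]: "Measurable.pred M P" and K: "hit_measurable M K" and L: "hit_measurable M L"
  shows "hit_measurable M (\<lambda>\<omega>. if P \<omega> then K \<omega> else L \<omega>)"
  unfolding hit_measurable_def
proof (intro conjI ballI allI impI)
  show "compact (if P \<omega> then K \<omega> else L \<omega>)" if "\<omega> \<in> space M" for \<omega>
    using hit_measurable_compact[OF K that] hit_measurable_compact[OF L that] by simp
  fix C :: "'b set" assume C: "closed C"
  note [measurable] = hit_measurable_pred[OF K C] hit_measurable_pred[OF L C]
  have "Measurable.pred M (\<lambda>\<omega>. if P \<omega> then K \<omega> \<inter> C \<noteq> {} else L \<omega> \<inter> C \<noteq> {})"
    by measurable
  moreover have "((if P \<omega> then K \<omega> else L \<omega>) \<inter> C \<noteq> {}) = (if P \<omega> then K \<omega> \<inter> C \<noteq> {} else L \<omega> \<inter> C \<noteq> {})" for \<omega>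
    by simp
  ultimately show "Measurable.pred M (\<lambda>\<omega>. (if P \<omega> then K \<omega> else L \<omega>) \<inter> C \<noteq> {})"
    by presburger
qed

text \<open>Measurability is imposed on norms of combinations alone, because they determine
  \<open>code_ball\<close> and through it the index. The carriers may consist of functions on which
  no measurable structure is given.\<close>

locale coded_family =
  fixes M :: "'w measure" and S :: "'w \<Rightarrow> 'a::real_vector set"
    and N :: "'w \<Rightarrow> 'a \<Rightarrow> real" and y :: "'w \<Rightarrow> nat \<Rightarrow> 'a"
  assumes coded: "\<omega> \<in> space M \<Longrightarrow> coded_space (S \<omega>) (N \<omega>) (y \<omega>)"
    and norm_measurable: "(\<lambda>\<omega>. N \<omega> (\<Sum>i<n. c i *\<^sub>R y \<omega> i)) \<in> borel_measurable M"
begin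

abbreviation E :: "'w \<Rightarrow> (nat \<Rightarrow> real) set" where
  "E \<omega> \<equiv> coded_space.code_ball (N \<omega>) (y \<omega>)"

lemma hit_measurable_code_ball: "hit_measurable M E"
proof (rule hit_measurable_cong)
  show "{g \<in> {g. \<forall>i. \<bar>g i\<bar> \<le> 1}. \<forall>q :: rat list.
     \<bar>\<Sum>i<length q. of_rat (q ! i) * g i\<bar> \<le> N \<omega> (\<Sum>i<length q. of_rat (q ! i) *\<^sub>R y \<omega> i)} = E \<omega>"
    if "\<omega> \<in> space M" for \<omega>
    using coded_space.code_ball_eq[OF coded[OF that]] by simp
  show "hit_measurable M (\<lambda>\<omega>. {g \<in> {g. \<forall>i. \<bar>g i\<bar> \<le> 1}. \<forall>q :: rat list.
     \<bar>\<Sum>i<length q. of_rat (q ! i) * g i\<bar> \<le> N \<omega> (\<Sum>i<length q. of_rat (q ! i) *\<^sub>R y \<omega> i)})"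
    by (intro hit_measurable_constraints compact_cube norm_measurable continuous_on_abs_coord_sum)
qed

lemma pred_szlenk_index_le:
  assumes \<alpha>: "\<alpha> < omega1"
  shows "Measurable.pred M (\<lambda>\<omega>. szlenk_index (S \<omega>) (N \<omega>) \<le> \<alpha>)"
proof -
  have [measurable]: "Measurable.pred M (\<lambda>\<omega>. sz_iter (1 / Suc m) (E \<omega>) (osucc \<alpha>) \<noteq> {})" for m
    using hit_measurable_pred[OF hit_measurable_sz_iter[OF hit_measurable_code_ball
          osucc_less_omega1[OF \<alpha>]], of UNIV "1 / Suc m"] by simp
  have "Measurable.pred M (\<lambda>\<omega>. \<forall>m. \<not> sz_iter (1 / Suc m) (E \<omega>) (osucc \<alpha>) \<noteq> {})"
    by measurable
  then show ?thesis
    by (subst measurable_cong[where g = "\<lambda>\<omega>. \<forall>m. \<not> sz_iter (1 / Suc m) (E \<omega>) (osucc \<alpha>) \<noteq> {}"])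
      (auto simp: coded_space.szlenk_index_le_iff[OF coded \<alpha>])
qed

text \<open>
  If the derivatives exhaust \<open>E \<omega>\<close>, every \<open>g\<close> leaves at some countable stage, and then a basic
  neighbourhood of \<open>g\<close> meets that stage in a set of small diameter; so points selected from the
  countably many such intersections are norm dense.
\<close>

lemma coded_family_dual:
  assumes \<alpha>: "\<alpha> < omega1" and sz: "\<And>\<omega>. \<omega> \<in> space M \<Longrightarrow> szlenk_index (S \<omega>) (N \<omega>) \<le> \<alpha>"
  obtains F where
    "coded_family M (\<lambda>\<omega>. dual (S \<omega>) (N \<omega>)) (\<lambda>\<omega>. dual_norm (S \<omega>) (N \<omega>)) F"
proof -
  obtain B :: "nat \<Rightarrow> (nat \<Rightarrow> real) set" where B: "\<And>n. open (B n)"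
    "\<And>U g. open U \<Longrightarrow> g \<in> U \<Longrightarrow> \<exists>n. g \<in> B n \<and> closure (B n) \<subseteq> U"
    using ex_countable_shrinking_base by metis
  \<comment> \<open>Stage \<open>osucc \<alpha>\<close> is empty for each \<open>1 / Suc m\<close>,
    so points can leave only in passing from a stage \<open>b \<le> \<alpha>\<close> to the next
    one.\<close>
  define A where "A = {..<osucc \<alpha>}"
  have A: "countable A" "A \<noteq> {}"
    using osucc_less_omega1[OF \<alpha>] less_osucc by (auto simp: A_def less_omega1_iff)
  have A_less: "a < omega1" if "a \<in> A" for a
    using that osucc_less_omega1[OF \<alpha>] by (auto simp: A_def)
  define K where "K = (\<lambda>(m, j, n) \<omega>. sz_iter (1 / Suc m) (E \<omega>) (from_nat_into A j) \<inter> closure (B n))"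
  define L where "L p \<omega> = (if K p \<omega> \<noteq> {} then K p \<omega> else E \<omega>)" for p \<omega>
  have hK: "hit_measurable M (K p)" for p
    using A_less[OF from_nat_into[OF A(2)]] unfolding K_def
    by (cases p) (auto intro!: hit_measurable_Int hit_measurable_sz_iter hit_measurable_code_ball)
  have hL: "hit_measurable M (L p)" for p
    using hit_measurable_pred[OF hK, of UNIV] unfolding L_def
    by (intro hit_measurable_If hK hit_measurable_code_ball) auto
  have neL: "L p \<omega> \<noteq> {}" if "\<omega> \<in> space M" for p \<omega>
    using coded_space.zero_in_code_ball[OF coded[OF that]] by (auto simp: L_def)
  have "\<exists>s. (\<forall>\<omega>\<in>space M. s \<omega> \<in> L p \<omega>) \<and> (\<forall>i. (\<lambda>\<omega>. s \<omega> i) \<in> borel_measurable M)" for p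
    using hit_measurable_selection[OF hL neL] by metis
  then obtain s where s: "\<And>p \<omega>. \<omega> \<in> space M \<Longrightarrow> s p \<omega> \<in> L p \<omega>"
    "\<And>p i. (\<lambda>\<omega>. s p \<omega> i) \<in> borel_measurable M"
    by metis
  have LE: "L p \<omega> \<subseteq> E \<omega>" for p \<omega>
    using sz_iter_antimono[of 0 _ _ "E \<omega>"] by (cases p) (auto simp: L_def K_def)
  have "\<exists>f. f \<in> dual_ball (S \<omega>) (N \<omega>) \<and> coded_space.code (y \<omega>) f = s p \<omega>" if \<omega>: "\<omega> \<in> space M" for \<omega> p
    using coded_space.code_surj[OF coded[OF \<omega>]] s(1)[OF \<omega>] LE by (metis subsetD)
  then obtain f where f: "\<And>\<omega> p. \<omega> \<in> space M \<Longrightarrow> f \<omega> p \<in> dual_ball (S \<omega>) (N \<omega>)"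
    "\<And>\<omega> p. \<omega> \<in> space M \<Longrightarrow> coded_space.code (y \<omega>) (f \<omega> p) = s p \<omega>"
    by metis
  define F where "F \<omega> k = f \<omega> (from_nat k)" for \<omega> k
  have F: "F \<omega> k \<in> dual (S \<omega>) (N \<omega>)" "dual_norm (S \<omega>) (N \<omega>) (F \<omega> k) \<le> 1"
    if "\<omega> \<in> space M" for \<omega> k
    using f(1)[OF that] by (auto simp: F_def dual_ball_def)
  have dense: "\<exists>k. dual_norm (S \<omega>) (N \<omega>) (h - F \<omega> k) < e"
    if \<omega>: "\<omega> \<in> space M" and h: "h \<in> dual (S \<omega>) (N \<omega>)" "dual_norm (S \<omega>) (N \<omega>) h \<le> 1"
      and e: "e > 0" for \<omega> h e
  proof -
    interpret coded_space "S \<omega>" "N \<omega>" "y \<omega>"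
      using \<omega> by (rule coded)
    obtain m :: nat where m: "1 / Suc m < e"
      using reals_Archimedean[OF e] by (auto simp: inverse_eq_divide)
    define T where "T = sz_iter (1 / Suc m) (E \<omega>)"
    define g where "g = code h"
    have g0: "g \<in> T 0"
      using h code_in_code_ball by (simp add: g_def T_def dual_ball_def)
    have "g \<notin> T (osucc \<alpha>)"
      using sz[OF \<omega>] \<alpha> by (simp add: szlenk_index_le_iff T_def del: sz_iter_osucc)
    \<comment> \<open>A point missing at a limit stage is already missing at an earlier one, so
      departure always happens at a successor.\<close>
    have "a \<le> osucc \<alpha> \<Longrightarrow> g \<notin> T a \<Longrightarrow> \<exists>b\<in>A. g \<in> T b \<and> g \<notin> T (osucc b)" for a
    proof (induction a rule: ordinal_limit_induct)
      case zero
      then show ?case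
        using g0 by simp
    next
      case (osucc a)
      then show ?case
        by (cases "g \<in> T a") (auto simp: A_def osucc_le_iff dest: less_imp_le)
    next
      case (limit a)
      then obtain b where "b < a" "g \<notin> T b"
        by (auto simp: T_def sz_iter_limit)
      then show ?case
        using limit.IH[of b] limit.prems(1) by auto
    qed
    then obtain b where b: "b \<in> A" "g \<in> T b" "g \<notin> T (osucc b)"
      using \<open>g \<notin> T (osucc \<alpha>)\<close> by blast
    then obtain U where U: "open U" "g \<in> U" "coord_small (1 / Suc m) (T b \<inter> U)"
      unfolding T_def sz_iter_osucc sz_deriv_def by blast
    obtain n where n: "g \<in> B n" "closure (B n) \<subseteq> U"
      using B(2)[OF U(1,2)] by blast
    obtain j where j: "from_nat_into A j = b"
      using from_nat_into_surj[OF A(1) b(1)] by blast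
    have Kp: "K (m, j, n) \<omega> = T b \<inter> closure (B n)"
      by (simp add: K_def j T_def)
    have "g \<in> K (m, j, n) \<omega>"
      using b(2) n(1) closure_subset by (auto simp: Kp)
    then have "s (m, j, n) \<omega> \<in> T b \<inter> U" "g \<in> T b \<inter> U"
      using s(1)[OF \<omega>, of "(m, j, n)"] n(2) Kp by (auto simp: L_def split: if_splits)
    then have "\<bar>code h i - code (f \<omega> (m, j, n)) i\<bar> \<le> 1 / Suc m" for i
      using U(3) f(2)[OF \<omega>] by (auto simp: coord_small_def g_def)
    then have "dual_norm (S \<omega>) (N \<omega>) (h - f \<omega> (m, j, n)) \<le> 1 / Suc m"
      using h(1) f(1)[OF \<omega>] by (subst dual_norm_diff_le_iff) (auto simp: dual_ball_def)
    then show ?thesis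
      using m by (intro exI[of _ "to_nat (m, j, n)"]) (simp add: F_def)
  qed
  have "coded_family M (\<lambda>\<omega>. dual (S \<omega>) (N \<omega>)) (\<lambda>\<omega>. dual_norm (S \<omega>) (N \<omega>)) F"
  proof (rule coded_family.intro)
    fix \<omega> assume \<omega>: "\<omega> \<in> space M"
    interpret coded_space "S \<omega>" "N \<omega>" "y \<omega>"
      using \<omega> by (rule coded)
    show "coded_space (dual (S \<omega>) (N \<omega>)) (dual_norm (S \<omega>) (N \<omega>)) (F \<omega>)"
      by standard (use F[OF \<omega>] dense[OF \<omega>] in
          \<open>auto simp: subspace_dual dual_norm_add dual_norm_scale\<close>)
  next
    fix n and c :: "nat \<Rightarrow> real"
    have sum_apply: "(\<Sum>k<n. c k *\<^sub>R F \<omega> k) x = (\<Sum>k<n. c k * F \<omega> k x)" for \<omega> x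
      by (induction n) (auto simp: scaleR_fun_def)
    \<comment> \<open>By linearity, a combination of the \<open>F \<omega> k\<close> has as
      coordinates the same combination of the selected sequences, so its dual norm is a countable
      supremum of measurable functions.\<close>
    have le: "dual_norm (S \<omega>) (N \<omega>) (\<Sum>k<n. c k *\<^sub>R F \<omega> k) \<le> a \<longleftrightarrow>
        (\<forall>i. \<bar>\<Sum>k<n. c k * s (from_nat k) \<omega> i\<bar> \<le> a)" if \<omega>: "\<omega> \<in> space M" for \<omega> a
    proof -
      interpret coded_space "S \<omega>" "N \<omega>" "y \<omega>"
        using \<omega> by (rule coded)
      have "(\<Sum>k<n. c k *\<^sub>R F \<omega> k) \<in> dual (S \<omega>) (N \<omega>)"
        using F[OF \<omega>] subspace_dual by (intro subspace_sum subspace_scale) auto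
      moreover have "F \<omega> k (y \<omega> i) = s (from_nat k) \<omega> i" for k i
        using f(2)[OF \<omega>, of "from_nat k"] by (auto simp: F_def code_def fun_eq_iff)
      ultimately show ?thesis
        by (simp add: dual_norm_le_iff sum_apply)
    qed
    note s(2)[measurable]
    have "Measurable.pred M (\<lambda>\<omega>. \<forall>i. \<bar>\<Sum>k<n. c k * s (from_nat k) \<omega> i\<bar> \<le> a)" for a
      by measurable
    then have "{\<omega> \<in> space M. \<forall>i. \<bar>\<Sum>k<n. c k * s (from_nat k) \<omega> i\<bar> \<le> a} \<in> sets M" for a
      by (simp add: pred_def)
    moreover have "{\<omega> \<in> space M. dual_norm (S \<omega>) (N \<omega>) (\<Sum>k<n. c k *\<^sub>R F \<omega> k) \<le> a} =
      {\<omega> \<in> space M. \<forall>i. \<bar>\<Sum>k<n. c k * s (from_nat k) \<omega> i\<bar> \<le> a}" for a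
      using le by blast
    ultimately show "(\<lambda>\<omega>. dual_norm (S \<omega>) (N \<omega>) (\<Sum>k<n. c k *\<^sub>R F \<omega> k)) \<in> borel_measurable M"
      by (simp add: borel_measurable_iff_le)
  qed
  then show ?thesis
    by (rule that)
qed

end

section \<open>The Effros--Borel space\<close>

lemma continuous_Rep_unit_interval: "continuous_on A Rep_unit_interval"
  unfolding continuous_on_iff by (auto simp: dist_unit_interval_def)

lemma continuous_Abs_unit_interval: "continuous_on {0..1} Abs_unit_interval"
  unfolding continuous_on_iff by (auto simp: dist_unit_interval_def Abs_unit_interval_inverse)

text \<open>Bernstein polynomials with rational coefficients are dense. As the Bernstein weights are
  nonnegative with sum 1, rounding every coefficient by less than r/4 moves the polynomial by at
  most r/4.\<close>

lemma ex_dense_sequence_C01: "\<exists>e :: nat \<Rightarrow> C01. \<forall>h. \<forall>r>0. \<exists>i. dist (e i) h < r"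
proof -
  define P where "P = (\<lambda>(n, q :: rat list) x. \<Sum>k\<le>n. real_of_rat (q ! k) * Bernstein n k x)"
  define T where "T p = Bcontfun (\<lambda>x. P p (Rep_unit_interval x))" for p
  have cont: "continuous_on A (P p)" for A p
    unfolding P_def Bernstein_def by (cases p) (auto intro!: continuous_intros)
  have T: "apply_bcontfun (T p) x = P p (Rep_unit_interval x)" for p x
  proof -
    have "continuous_on UNIV (\<lambda>x. P p (Rep_unit_interval x))"
      by (rule continuous_on_compose2[OF cont continuous_Rep_unit_interval subset_UNIV])
    moreover have "bounded (P p ` {0..1})"
      by (intro compact_imp_bounded compact_continuous_image cont) simp
    then have "bounded (range (\<lambda>x. P p (Rep_unit_interval x)))"
      by (rule bounded_subset) (use Rep_unit_interval in blast)
    ultimately have "(\<lambda>x. P p (Rep_unit_interval x)) \<in> bcontfun"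
      by (simp add: bcontfun_def)
    then show ?thesis
      by (simp add: T_def Bcontfun_inverse)
  qed
  have "\<exists>p. dist (T p) h < r" if r: "r > 0" for h r
  proof -
    define f where "f x = apply_bcontfun h (Abs_unit_interval x)" for x
    have "continuous_on {0..1} f"
      unfolding f_def
      by (rule continuous_on_compose2[OF continuous_on_apply_bcontfun continuous_Abs_unit_interval subset_UNIV])
    then obtain n where n: "\<And>x. x \<in> {0..1} \<Longrightarrow> \<bar>f x - (\<Sum>k\<le>n. f (k / n) * Bernstein n k x)\<bar> < r / 4"
      using Bernstein_Weierstrass[of f "r / 4"] r by auto
    have "\<exists>q. \<bar>f (k / n) - real_of_rat q\<bar> < r / 4" for k :: nat
    proof -
      obtain q where "f (k / n) - r / 4 < real_of_rat q" "real_of_rat q < f (k / n)"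
        using of_rat_dense[of "f (k / n) - r / 4" "f (k / n)"] r by auto
      then show ?thesis
        by (intro exI[of _ q]) auto
    qed
    then obtain g where g: "\<And>k :: nat. \<bar>f (k / n) - real_of_rat (g k)\<bar> < r / 4"
      by metis
    define q where "q = map g [0..<Suc n]"
    have q: "q ! k = g k" if "k \<le> n" for k
      using that unfolding q_def by (simp del: upt_Suc)
    have le: "dist (P (n, q) x) (f x) \<le> r / 2" if x: "x \<in> {0..1}" for x
    proof -
      have "\<bar>(\<Sum>k\<le>n. f (k / n) * Bernstein n k x) - P (n, q) x\<bar> =
          \<bar>\<Sum>k\<le>n. (f (k / n) - real_of_rat (g k)) * Bernstein n k x\<bar>"
        by (simp add: P_def q left_diff_distrib sum_subtractf)
      also have "\<dots> \<le> (\<Sum>k\<le>n. \<bar>(f (k / n) - real_of_rat (g k)) * Bernstein n k x\<bar>)"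
        by (rule sum_abs)
      also have "\<dots> \<le> (\<Sum>k\<le>n. r / 4 * Bernstein n k x)"
      proof (rule sum_mono)
        fix k
        have "0 \<le> Bernstein n k x"
          using x by (simp add: Bernstein_nonneg)
        then show "\<bar>(f (k / n) - real_of_rat (g k)) * Bernstein n k x\<bar> \<le> r / 4 * Bernstein n k x"
          unfolding abs_mult using g[of k] by (simp only: abs_of_nonneg) (rule mult_right_mono[OF less_imp_le])
      qed
      also have "\<dots> = r / 4"
        by (simp only: sum_distrib_left[symmetric] sum_Bernstein mult_1_right)
      finally show ?thesis
        using n[OF x] unfolding dist_real_def by linarith
    qed
    have "dist (T (n, q)) h \<le> r / 2"
    proof (rule dist_bound)
      fix x
      show "dist (apply_bcontfun (T (n, q)) x) (apply_bcontfun h x) \<le> r / 2"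
        using le[OF Rep_unit_interval[of x]] by (simp add: T f_def Rep_unit_interval_inverse)
    qed
    then show ?thesis
      using r by (intro exI[of _ "(n, q)"]) simp
  qed
  then show ?thesis
    by (intro exI[of _ "\<lambda>i. T (from_nat i)"]) (metis from_nat_to_nat)
qed

section \<open>Measurable choice of points in closed subspaces\<close>

lemma space_effros_borel: "space effros_borel = SB"
  unfolding effros_borel_def by (rule space_measure_of) auto

lemma pred_effros_borel_hit:
  assumes "open U"
  shows "Measurable.pred effros_borel (\<lambda>X. X \<inter> U \<noteq> {})"
proof -
  have "{F \<in> SB. F \<inter> U \<noteq> {}} \<in> sets effros_borel"
    unfolding effros_borel_def using assms by (subst sets_measure_of) (auto intro: sigma_sets.Basic)
  then show ?thesis
    by (simp add: pred_def space_effros_borel)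
qed

text \<open>Lists over a countable type are countable, so the last entry may be appended for each
  fixed initial list separately.\<close>

lemma measurable_upt_map_count_space:
  assumes [measurable]: "\<And>i. k i \<in> M \<rightarrow>\<^sub>M count_space UNIV"
  shows "(\<lambda>\<omega>. map (\<lambda>i. k i \<omega> :: 'c::countable) [0..<n]) \<in> M \<rightarrow>\<^sub>M count_space UNIV"
proof (induction n)
  case (Suc n)
  have "(\<lambda>\<omega>. l @ [k n \<omega>]) \<in> M \<rightarrow>\<^sub>M count_space UNIV" for l
    by measurable
  from measurable_compose_countable[OF this Suc] show ?case
    by simp
qed simp

text \<open>
  The shrinking balls force the chosen \<open>e n\<close> to converge to a point of \<open>X\<close> in the closure of \<open>U\<close>,
  and each choice, being a least natural number, depends measurably on \<open>X\<close>.
\<close>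

definition search_region :: "(nat \<Rightarrow> 'b::metric_space) \<Rightarrow> 'b set \<Rightarrow> nat list \<Rightarrow> 'b set" where
  "search_region e U l = U \<inter> (\<Inter>j<length l. ball (e (l ! j)) (1 / 2 ^ j))"

primrec hit_search :: "(nat \<Rightarrow> 'b::metric_space) \<Rightarrow> 'b set \<Rightarrow> 'b set \<Rightarrow> nat \<Rightarrow> nat list" where
  "hit_search e U X 0 = []"
| "hit_search e U X (Suc j) = hit_search e U X j @
     [LEAST n. X \<inter> (search_region e U (hit_search e U X j) \<inter> ball (e n) (1 / 2 ^ j)) \<noteq> {}]"

lemma length_hit_search [simp]: "length (hit_search e U X j) = j"
  by (induction j) auto

lemma nth_hit_search: "i < j \<Longrightarrow> hit_search e U X j ! i = hit_search e U X (Suc i) ! i"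
  by (induction j) (auto simp: nth_append less_Suc_eq)

lemma open_search_region: "open U \<Longrightarrow> open (search_region e U l)"
  unfolding search_region_def by (intro open_Int open_INT) auto

lemma search_region_snoc:
  "search_region e U (l @ [n]) = search_region e U l \<inter> ball (e n) (1 / 2 ^ length l)"
proof -
  have "ball (e ((l @ [n]) ! j)) (1 / 2 ^ j) = ball (e (l ! j)) (1 / 2 ^ j)" if "j \<in> {..<length l}" for j
    using that by (simp add: nth_append)
  then have "(\<Inter>j<length l. ball (e ((l @ [n]) ! j)) (1 / 2 ^ j)) = (\<Inter>j<length l. ball (e (l ! j)) (1 / 2 ^ j))"
    by (rule INF_cong[OF refl])
  then show ?thesis
    by (simp add: search_region_def lessThan_Suc Int_ac)
qed

lemma hit_search_hits:
  assumes dense: "\<And>x r. r > 0 \<Longrightarrow> \<exists>i. dist (e i) x < r" and ne: "X \<inter> U \<noteq> {}"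
  shows "X \<inter> search_region e U (hit_search e U X j) \<noteq> {}"
proof (induction j)
  case 0
  then show ?case
    using ne by (simp add: search_region_def)
next
  case (Suc j)
  then obtain x where x: "x \<in> X \<inter> search_region e U (hit_search e U X j)"
    by blast
  obtain n where "dist (e n) x < 1 / 2 ^ j"
    using dense[of "1 / 2 ^ j" x] by auto
  then have "X \<inter> (search_region e U (hit_search e U X j) \<inter> ball (e n) (1 / 2 ^ j)) \<noteq> {}"
    using x by auto
  from LeastI[of "\<lambda>n. X \<inter> (search_region e U (hit_search e U X j) \<inter> ball (e n) (1 / 2 ^ j)) \<noteq> {}", OF this]
  show ?case
    by (simp add: search_region_snoc)
qed

lemma hit_search_limit:
  fixes e :: "nat \<Rightarrow> 'b::complete_space"
  assumes dense: "\<And>x r. r > 0 \<Longrightarrow> \<exists>i. dist (e i) x < r" and ne: "X \<inter> U \<noteq> {}" and X: "closed X"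
  obtains y where "y \<in> X" "y \<in> closure U" "(\<lambda>j. e (hit_search e U X (Suc j) ! j)) \<longlonglongrightarrow> y"
proof -
  define a where "a j = e (hit_search e U X (Suc j) ! j)" for j
  \<comment> \<open>The points \<open>e n\<close> need not lie in \<open>X\<close>. Witnesses from
    \<open>X\<close> in the successive regions are needed to place the limit in
    \<open>X\<close>.\<close>
  have "\<exists>x. x \<in> X \<inter> search_region e U (hit_search e U X (Suc j))" for j
    using hit_search_hits[OF dense ne] by blast
  then obtain x where x: "\<And>j. x j \<in> X \<inter> search_region e U (hit_search e U X (Suc j))"
    by metis
  have near: "dist (a i) (x j) < 1 / 2 ^ i" if "i \<le> j" for i j
  proof -
    have "x j \<in> ball (e (hit_search e U X (Suc j) ! i)) (1 / 2 ^ i)"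
      using x[of j] that unfolding search_region_def by auto
    moreover have "hit_search e U X (Suc j) ! i = hit_search e U X (Suc i) ! i"
      by (rule nth_hit_search) (use that in simp)
    ultimately show ?thesis
      by (simp add: a_def del: hit_search.simps)
  qed
  have pow: "\<exists>i. 1 / 2 ^ i < r" if "r > 0" for r :: real
    using real_arch_pow_inv[OF that, of "1 / 2"] by (auto simp: power_one_over)
  have "Cauchy x"
  proof (rule metric_CauchyI)
    fix r :: real assume "r > 0"
    then obtain i where i: "1 / 2 ^ i < r / 2"
      using pow[of "r / 2"] by auto
    have "dist (x m) (x n) < r" if "m \<ge> i" "n \<ge> i" for m n
      using near[OF that(1)] near[OF that(2)] i dist_triangle3[of "x m" "x n" "a i"] by linarith
    then show "\<exists>M. \<forall>m\<ge>M. \<forall>n\<ge>M. dist (x m) (x n) < r"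
      by blast
  qed
  then obtain y where y: "x \<longlonglongrightarrow> y"
    using Cauchy_convergent_iff convergent_def by blast
  have "y \<in> X"
    using X _ y by (rule closed_sequentially) (use x in blast)
  moreover have "y \<in> closure U"
    using x y unfolding closure_sequential search_region_def by blast
  moreover have "a \<longlonglongrightarrow> y"
  proof (rule metric_LIMSEQ_I)
    fix r :: real assume r: "r > 0"
    then obtain i where i: "1 / 2 ^ i < r / 2"
      using pow[of "r / 2"] by auto
    obtain m where m: "\<And>n. n \<ge> m \<Longrightarrow> dist (x n) y < r / 2"
      using metric_LIMSEQ_D[OF y, of "r / 2"] r by auto
    have "dist (a n) y < r" if n: "n \<ge> max i m" for n
    proof -
      have "(1 :: real) / 2 ^ n \<le> 1 / 2 ^ i"
        using n by (intro divide_left_mono power_increasing) auto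
      then show ?thesis
        using near[of n n] m[of n] n i dist_triangle[of "a n" y "x n"] by auto
    qed
    then show "\<exists>m. \<forall>n\<ge>m. dist (a n) y < r"
      by blast
  qed
  ultimately show ?thesis
    unfolding a_def by (rule that)
qed

lemma measurable_hit_search:
  assumes "open U"
  shows "(\<lambda>X. hit_search e U X j) \<in> effros_borel \<rightarrow>\<^sub>M count_space UNIV"
proof (induction j)
  case (Suc j)
  have "(\<lambda>X. l @ [LEAST n. X \<inter> (search_region e U l \<inter> ball (e n) (1 / 2 ^ j)) \<noteq> {}])
      \<in> effros_borel \<rightarrow>\<^sub>M count_space UNIV" for l
  proof -
    have [measurable]: "Measurable.pred effros_borel
        (\<lambda>X. X \<inter> (search_region e U l \<inter> ball (e n) (1 / 2 ^ j)) \<noteq> {})" for n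
      by (intro pred_effros_borel_hit open_Int open_search_region assms open_ball)
    show ?thesis
      by measurable
  qed
  from measurable_compose_countable[OF this Suc] show ?case
    by simp
qed simp

lemma coded_family_effros_borel:
  obtains y where "coded_family effros_borel (\<lambda>X :: C01 set. X) (\<lambda>_. norm) y"
proof -
  obtain e :: "nat \<Rightarrow> C01" where dense: "\<And>h r. r > 0 \<Longrightarrow> \<exists>i. dist (e i) h < r"
    using ex_dense_sequence_C01 by blast
  \<comment> \<open>Small balls localise the selected point; intersecting with the open unit ball
    keeps it, as a point of the closure, in the closed unit ball.\<close>
  define U where "U = (\<lambda>(i, k :: nat). ball (e i) (1 / Suc k) \<inter> ball 0 1)"
  have U: "open (U p)" for p
    by (cases p) (auto simp: U_def)
  have clU: "closure (U (i, k)) \<subseteq> cball (e i) (1 / Suc k) \<inter> cball 0 1" for i k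
    unfolding U_def by (intro closure_minimal) (auto simp: mem_ball_imp_mem_cball)
  \<comment> \<open>Indices are shifted by one so that 0 can stand for the zero vector
    (\<open>v 0 = 0\<close>), the default when \<open>X\<close> misses \<open>U p\<close>.\<close>
  define k where "k j p X = (if X \<inter> U p \<noteq> {} then Suc (hit_search e (U p) X (Suc j) ! j) else 0)" for j p X
  define v where "v n = (case n of 0 \<Rightarrow> 0 | Suc m \<Rightarrow> e m)" for n
  have meas_k [measurable]: "k j p \<in> effros_borel \<rightarrow>\<^sub>M count_space UNIV" for j p
  proof -
    note [measurable] = measurable_hit_search[OF U] pred_effros_borel_hit[OF U]
    show ?thesis
      unfolding k_def by measurable
  qed
  have "\<exists>z. z \<in> X \<and> (\<lambda>j. v (k j p X)) \<longlonglongrightarrow> z \<and> norm z \<le> 1 \<and> (X \<inter> U p \<noteq> {} \<longrightarrow> z \<in> closure (U p))"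
    if X: "X \<in> SB" for X p
  proof (cases "X \<inter> U p = {}")
    case True
    then show ?thesis
      using X by (intro exI[of _ 0]) (auto simp: k_def v_def SB_def subspace_0)
  next
    case False
    have "closed X"
      using X by (simp add: SB_def)
    with dense False obtain z where z: "z \<in> X" "z \<in> closure (U p)" "(\<lambda>j. e (hit_search e (U p) X (Suc j) ! j)) \<longlonglongrightarrow> z"
      by (rule hit_search_limit)
    have "norm z \<le> 1"
      using z(2) clU[of "fst p" "snd p"] by auto
    moreover have "(\<lambda>j. v (k j p X)) = (\<lambda>j. e (hit_search e (U p) X (Suc j) ! j))"
      using False by (simp add: k_def v_def del: hit_search.simps)
    ultimately show ?thesis
      using z by (intro exI[of _ z]) simp
  qed
  then obtain z where z: "\<And>X p. X \<in> SB \<Longrightarrow> z X p \<in> X"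
    "\<And>X p. X \<in> SB \<Longrightarrow> (\<lambda>j. v (k j p X)) \<longlonglongrightarrow> z X p"
    "\<And>X p. X \<in> SB \<Longrightarrow> norm (z X p) \<le> 1"
    "\<And>X p. X \<in> SB \<Longrightarrow> X \<inter> U p \<noteq> {} \<Longrightarrow> z X p \<in> closure (U p)"
    by metis
  have z_dense: "\<exists>p. norm (x - z X p) < r" if X: "X \<in> SB" and x: "x \<in> X" "norm x \<le> 1" and r: "r > 0" for X x r
  proof -
    \<comment> \<open>Contracting \<open>x\<close> moves it by at most r/4 into the open unit ball,
      where the sets \<open>U p\<close> lie; the minimum with 1/2 keeps \<open>t\<close>
      positive.\<close>
    define t where "t = 1 - min (r / 4) (1 / 2)"
    have t: "0 < t" "t < 1" "1 - t \<le> r / 4"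
      using r by (auto simp: t_def)
    have "t * norm x \<le> t * 1"
      using x(2) t(1) by (intro mult_left_mono) auto
    moreover have "norm (t *\<^sub>R x) = t * norm x"
      using t by simp
    ultimately have "norm (t *\<^sub>R x) < 1"
      using t(2) by linarith
    moreover have "t *\<^sub>R x \<in> X"
      using X x(1) by (simp add: SB_def subspace_scale)
    ultimately have tx: "t *\<^sub>R x \<in> X \<inter> ball 0 1"
      by simp
    have "norm (x - t *\<^sub>R x) = (1 - t) * norm x"
      using t norm_scaleR[of "1 - t" x] by (simp add: algebra_simps)
    also have "\<dots> \<le> r / 4"
      using t x(2) mult_left_le[of "norm x" "1 - t"] by linarith
    finally have 1: "dist x (t *\<^sub>R x) \<le> r / 4"
      by (simp add: dist_norm)
    obtain k where k: "1 / Suc k < r / 4"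
      using reals_Archimedean[of "r / 4"] r by (auto simp: inverse_eq_divide)
    obtain i where i: "dist (e i) (t *\<^sub>R x) < 1 / Suc k"
      using dense[of "1 / Suc k" "t *\<^sub>R x"] by auto
    have "t *\<^sub>R x \<in> X \<inter> U (i, k)"
      using tx i by (simp add: U_def)
    then have "z X (i, k) \<in> cball (e i) (1 / Suc k)"
      using z(4)[OF X, of "(i, k)"] clU[of i k] by blast
    then have "dist (e i) (z X (i, k)) \<le> 1 / Suc k"
      by simp
    then have "dist x (z X (i, k)) < r"
      using 1 i k r dist_triangle[of x "z X (i, k)" "t *\<^sub>R x"] dist_triangle3[of "t *\<^sub>R x" "z X (i, k)" "e i"]
      by linarith
    then show ?thesis
      by (auto simp: dist_norm)
  qed
  have "coded_family effros_borel (\<lambda>X :: C01 set. X) (\<lambda>_. norm) (\<lambda>X i. z X (from_nat i))"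
  proof (rule coded_family.intro)
    fix X :: "C01 set" assume "X \<in> space effros_borel"
    then have X: "X \<in> SB"
      by (simp add: space_effros_borel)
    show "coded_space X norm (\<lambda>i. z X (from_nat i))"
    proof
      show "subspace X"
        using X by (simp add: SB_def)
      show "\<exists>i. norm (x - z X (from_nat i)) < r" if "x \<in> X" "norm x \<le> 1" "r > 0" for x r
        using z_dense[OF X that] by (metis from_nat_to_nat)
    qed (use z[OF X] in \<open>auto intro: norm_triangle_ineq\<close>)
  next
    fix n and c :: "nat \<Rightarrow> real"
    show "(\<lambda>X. norm (\<Sum>i<n. c i *\<^sub>R z X (from_nat i))) \<in> borel_measurable effros_borel"
    proof (rule borel_measurable_LIMSEQ_metric)
      fix X assume "X \<in> space effros_borel"
      then have X: "X \<in> SB"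
        by (simp add: space_effros_borel)
      show "(\<lambda>j. norm (\<Sum>i<n. c i *\<^sub>R v (k j (from_nat i) X))) \<longlonglongrightarrow>
          norm (\<Sum>i<n. c i *\<^sub>R z X (from_nat i))"
        by (intro tendsto_norm tendsto_sum tendsto_scaleR tendsto_const z(2)[OF X])
    next
      fix j
      \<comment> \<open>At fixed \<open>j\<close> the norm depends on \<open>X\<close> only through
        \<open>n\<close> natural numbers. Their list lies in a discrete space, on which every real
        function is measurable.\<close>
      have "(\<lambda>X. map (\<lambda>i. k j (from_nat i) X) [0..<n]) \<in> effros_borel \<rightarrow>\<^sub>M count_space UNIV"
        by (rule measurable_upt_map_count_space) (rule meas_k)
      then have "(\<lambda>X. (\<lambda>l. norm (\<Sum>i<n. c i *\<^sub>R v (l ! i))) (map (\<lambda>i. k j (from_nat i) X) [0..<n]))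
          \<in> borel_measurable effros_borel"
        by (rule measurable_compose) simp
      then show "(\<lambda>X. norm (\<Sum>i<n. c i *\<^sub>R v (k j (from_nat i) X))) \<in> borel_measurable effros_borel"
        by simp
    qed
  qed
  then show ?thesis
    by (rule that)
qed

theorem corollary1p3:
  fixes \<alpha> :: ordinal
  assumes "\<alpha> < omega1" and "\<alpha> = oexp omega \<alpha>"
  shows "{X \<in> SB. max (szlenk_index X norm)
                      (szlenk_index (dual X norm) (dual_norm X norm)) \<le> \<alpha>}
         \<in> sets effros_borel"
proof -
  obtain y where y: "coded_family effros_borel (\<lambda>X :: C01 set. X) (\<lambda>_. norm) y"
    by (rule coded_family_effros_borel)
  define A where "A = {X \<in> SB. szlenk_index X norm \<le> \<alpha>}"
  have A: "A \<in> sets effros_borel"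
    using coded_family.pred_szlenk_index_le[OF y assms(1)]
    by (simp add: pred_def space_effros_borel A_def)
  \<comment> \<open>\<open>coded_family_dual\<close> requires the index bound at every point of the
    parameter space, so the space is cut down to \<open>A\<close>. As \<open>A\<close> is Borel,
    measurable subsets of \<open>M\<close> are Borel in the whole space.\<close>
  define M where "M = restrict_space effros_borel A"
  have space_M: "space M = A"
    using A by (simp add: M_def)
  have y_M: "coded_family M (\<lambda>X :: C01 set. X) (\<lambda>_. norm) y"
  proof (rule coded_family.intro)
    show "coded_space X norm (y X)" if "X \<in> space M" for X
      using that coded_family.coded[OF y, of X] by (simp add: space_M A_def space_effros_borel)
    show "(\<lambda>X. norm (\<Sum>i<n. c i *\<^sub>R y X i)) \<in> borel_measurable M" for n c
      unfolding M_def by (intro measurable_restrict_space1 coded_family.norm_measurable[OF y])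
  qed
  obtain F where F: "coded_family M (\<lambda>X :: C01 set. dual X norm) (\<lambda>X. dual_norm X norm) F"
    using coded_family.coded_family_dual[OF y_M assms(1)] by (auto simp: space_M A_def)
  have "{X \<in> A. szlenk_index (dual X norm) (dual_norm X norm) \<le> \<alpha>} \<in> sets M"
    using coded_family.pred_szlenk_index_le[OF F assms(1)] by (simp add: pred_def space_M)
  then have "{X \<in> A. szlenk_index (dual X norm) (dual_norm X norm) \<le> \<alpha>} \<in> sets effros_borel"
    using A sets.sets_into_space[OF A] by (auto simp: M_def sets_restrict_space_iff Int_absorb2)
  moreover have "{X \<in> SB. max (szlenk_index X norm) (szlenk_index (dual X norm) (dual_norm X norm)) \<le> \<alpha>} =
      {X \<in> A. szlenk_index (dual X norm) (dual_norm X norm) \<le> \<alpha>}"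
    by (auto simp: A_def)
  ultimately show ?thesis
    by simp
qed

end
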